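(* Let $A_{J(q)}=(\Gamma_{\mathbb R}/\Gamma,J(q))$ be a complex torus obtained by the $\mathbf G$-construction with $R=\mathrm{End}(A_{J(q)})$. Then for any $\omega=\varphi_1+i\varphi_2\in NS_{A_{J(q)}}(\mathbb C)$ with nondegenerate $\varphi_2$, the pair $(A_{J(q)},\omega)$ has a mirror symmetric (weak) pair.
   Context: A complex torus is $A=(V/\Gamma,J)$ with $\Gamma=\Gamma_A=H_1(A,\mathbb Z)$ a lattice of rank $2\dim A$, $V=V_A=\Gamma\otimes\mathbb R$, and $J=J_A\in\mathrm{End}(V)$, $J^2=-1$. The dual torus is $\hat A=(V^*/\Gamma^*,\hat J)$, $(\hat Jw)(v)=w(-Jv)$. The Néron–Severi group $NS_A$ is identified (by first Chern class) with the group of integral skew-symmetric forms $c$ on $\Gamma$ with $c_{\mathbb R}$ $J$-invariant, and with a subgroup of $\mathrm{Hom}(A,\hat A)$ via $c\mapsto(v\mapsto c(v,\cdot))$. $NS_A(\mathbb R)=NS_A\otimes\mathbb R$, $NS_A(\mathbb C)=NS_A\otimes\mathbb C$; $NS_A(\mathbb C)^0=\{\varphi_1+i\varphi_2\in NS_A(\mathbb C):\varphi_1,\varphi_2\in NS_A(\mathbb R),\ \varphi_2\text{ nondegenerate}\}$. Put $\Lambda_A=\Gamma_A\oplus\Gamma_{\hat A}$ ($\Gamma_{\hat A}=\Gamma_A^*$) with $Q_A((a_1,b_1),(a_2,b_2))=b_1(a_2)+b_2(a_1)$; $J_{A\times\hat A}=(J,\hat J)$ acts on $V_A\oplus V_{\hat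 A}$. For $\omega=\varphi_1+i\varphi_2\in NS_A(\mathbb C)^0$ (with $\varphi_k:V_A\to V_{\hat A}$) put $$I_\omega=\begin{pmatrix}\varphi_2^{-1}\varphi_1&-\varphi_2^{-1}\\ \varphi_2+\varphi_1\varphi_2^{-1}\varphi_1&-\varphi_1\varphi_2^{-1}\end{pmatrix},$$ a complex structure on $V_A\oplus V_{\hat A}$. A weak pair $(A,\omega_A)$ is a complex torus $A$ with $\omega_A\in NS_A(\mathbb C)^0$. Weak pairs $(A,\omega_A)$, $(B,\omega_B)$ are mirror symmetric if there is an isomorphism $\alpha:\Lambda_A\to\Lambda_B$ identifying $Q_A$ with $Q_B$ such that $\alpha_{\mathbb R}J_{A\times\hat A}=I_{\omega_B}\alpha_{\mathbb R}$ and $\alpha_{\mathbb R}I_{\omega_A}=J_{B\times\hat B}\alpha_{\mathbb R}$. $\mathbf G$-construction. Let $R$ be an order in a finite-dimensional $\mathbb Q$-algebra $D=R\otimes_{\mathbb Z}\mathbb Q$, and let $\Gamma$ be a left $R$-module such that: (1) $\Gamma\cong\mathbb Z^{2n}$ as an abelian group; (2) $\Gamma$ is faithful, i.e. $R\to\mathrm{End}_{\mathbb Z}(\Gamma)$ is injective; (3) $\{a\in D: a(\Gamma)\subset\Gamma\}=R$; (4) $\Gamma=\Gamma_1\oplus\Gamma_2$ as $R$-modules, and there is an isomorphism $e:M_1\to M_2$ of $D$-modules, where $M_i=\Gamma_i\otimes\mathbb Q$; fix $e$ and identify $M_1$ and $M_2$ with one $D$-module $M$ by means of $e$; (5) there is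 a rational (nondegenerate) symmetric form $g:M\times M\to\mathbb Q$ such that the (image of the) algebra $D$ in $\mathrm{End}_{\mathbb Q}(M)$ is invariant under the anti-involution $\tilde a=g^{-1}a^tg$ of $\mathrm{End}_{\mathbb Q}(M)$ (adjoint with respect to $g$). Let $C=\mathrm{End}_D(M)$ (also stable under $\tilde{}$), and let $S(D)$, $S(C)$ be the subspaces of elements with $\tilde a=a$. For $q=q_1+iq_2\in S(C)\otimes\mathbb C$ ($q_1,q_2\in S(C)\otimes\mathbb R$) with $q_2$ invertible put $$J(q)=\begin{pmatrix}q_2^{-1}q_1&-q_2^{-1}\\ q_2+q_1q_2^{-1}q_1&-q_1q_2^{-1}\end{pmatrix}$$ acting on $\Gamma_{\mathbb R}=(M\oplus M)_{\mathbb R}$; then $J(q)^2=-1$. The complex torus $A_{J(q)}=(\Gamma_{\mathbb R}/\Gamma,J(q))$ is said to be obtained by the $\mathbf G$-construction. One always has $R\subseteq\mathrm{End}(A_{J(q)})$ inside $\mathrm{End}_{\mathbb Z}(\Gamma)$. *)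

theory Defs
  imports "HOL-Analysis.Analysis"
begin

text \<open>
  Convention: a free abelian group \<open>\<Gamma>\<close> of finite rank is represented inside its real span
  \<open>V = \<Gamma> \<otimes> \<real>\<close>, and \<open>\<Gamma> \<otimes> \<rat>\<close> is its rational span in \<open>V\<close>.  Homomorphisms and bilinear forms on
  \<open>\<Gamma>\<close> or on \<open>\<Gamma> \<otimes> \<rat>\<close> are represented by their unique real-linear extensions, which are bounded
  since \<open>V\<close> has finite dimension.  No metric structure of \<open>V\<close> is used.
\<close>

subsection \<open>Linear algebra\<close>

definition invertible_blinfun ::
    "('a::real_normed_vector \<Rightarrow>\<^sub>L 'b::real_normed_vector) \<Rightarrow> bool" where
  "invertible_blinfun f \<longleftrightarrow> (\<exists>h. h o\<^sub>L f = id_blinfun \<and> f o\<^sub>L h = id_blinfun)"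

definition inv_blinfun ::
    "('a::real_normed_vector \<Rightarrow>\<^sub>L 'b::real_normed_vector) \<Rightarrow> ('b \<Rightarrow>\<^sub>L 'a)" where
  "inv_blinfun f = (THE h. h o\<^sub>L f = id_blinfun \<and> f o\<^sub>L h = id_blinfun)"

lift_definition transpose_blinfun ::
    "('a::real_normed_vector \<Rightarrow>\<^sub>L 'b::real_normed_vector) \<Rightarrow> (('b \<Rightarrow>\<^sub>L real) \<Rightarrow>\<^sub>L ('a \<Rightarrow>\<^sub>L real))"
  is "\<lambda>f w. w o\<^sub>L f"
  by (intro bounded_linear_intros)

text \<open>The block matrix with rows \<open>(a, b)\<close> and \<open>(c, d)\<close>.\<close>

lift_definition block_blinfun ::
    "('a::real_normed_vector \<Rightarrow>\<^sub>L 'c::real_normed_vector) \<Rightarrow> ('b::real_normed_vector \<Rightarrow>\<^sub>L 'c) \<Rightarrow>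
     ('a \<Rightarrow>\<^sub>L 'd::real_normed_vector) \<Rightarrow> ('b \<Rightarrow>\<^sub>L 'd) \<Rightarrow> (('a \<times> 'b) \<Rightarrow>\<^sub>L ('c \<times> 'd))"
  is "\<lambda>a b c d z. (a (fst z) + b (snd z), c (fst z) + d (snd z))"
  by (intro bounded_linear_Pair bounded_linear_add)
     (auto intro: bounded_linear_compose bounded_linear_fst bounded_linear_snd)

definition nondegenerate_form :: "('a::real_normed_vector \<Rightarrow>\<^sub>L 'a \<Rightarrow>\<^sub>L real) \<Rightarrow> bool" where
  "nondegenerate_form c \<longleftrightarrow> (\<forall>v. (\<forall>w. c v w = 0) \<longrightarrow> v = 0)"

text \<open>This formula gives both \<open>I\<^sub>\<omega>\<close> (for \<open>\<phi>\<^sub>k : V \<rightarrow> V\<^sup>*\<close>) and \<open>J(q)\<close> (for \<open>q\<^sub>k : M \<rightarrow> M\<close>).\<close>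

definition matrix_cstr ::
    "('a::real_normed_vector \<Rightarrow>\<^sub>L 'b::real_normed_vector) \<Rightarrow> ('a \<Rightarrow>\<^sub>L 'b) \<Rightarrow> (('a \<times> 'b) \<Rightarrow>\<^sub>L ('a \<times> 'b))" where
  "matrix_cstr \<phi>1 \<phi>2 =
     block_blinfun (inv_blinfun \<phi>2 o\<^sub>L \<phi>1)               (- inv_blinfun \<phi>2)
                   (\<phi>2 + (\<phi>1 o\<^sub>L inv_blinfun \<phi>2 o\<^sub>L \<phi>1)) (- (\<phi>1 o\<^sub>L inv_blinfun \<phi>2))"

definition full_lattice :: "'a::real_vector set \<Rightarrow> bool" where
  "full_lattice \<Gamma> \<longleftrightarrow>
     (\<exists>B. finite B \<and> independent B \<and> span B = UNIV \<and> \<Gamma> = {\<Sum>b\<in>B. of_int (k b) *\<^sub>R b | k. True})"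

definition rational_span :: "'a::real_vector set \<Rightarrow> 'a set" where
  "rational_span \<Gamma> = {of_rat r *\<^sub>R x | r x. x \<in> \<Gamma>}"


subsection \<open>Complex tori and weak pairs\<close>

record (overloaded) ('v::real_normed_vector) torus =
  lat :: "'v set"
  cstr :: "'v \<Rightarrow>\<^sub>L 'v"

definition complex_torus :: "('v::real_normed_vector) torus \<Rightarrow> bool" where
  "complex_torus A \<longleftrightarrow> full_lattice (lat A) \<and> cstr A o\<^sub>L cstr A = - id_blinfun"

definition End_torus :: "('v::real_normed_vector) torus \<Rightarrow> ('v \<Rightarrow>\<^sub>L 'v) set" where
  "End_torus A = {f. blinfun_apply f ` lat A \<subseteq> lat A \<and> f o\<^sub>L cstr A = cstr A o\<^sub>L f}"

definition dual_torus :: "('v::real_normed_vector) torus \<Rightarrow> ('v \<Rightarrow>\<^sub>L real) torus" where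
  "dual_torus A =
     \<lparr>lat = {w. \<forall>x\<in>lat A. blinfun_apply w x \<in> \<int>}, cstr = transpose_blinfun (- cstr A)\<rparr>"

definition prod_torus ::
    "('v::real_normed_vector) torus \<Rightarrow> ('w::real_normed_vector) torus \<Rightarrow> ('v \<times> 'w) torus" where
  "prod_torus A B = \<lparr>lat = lat A \<times> lat B, cstr = block_blinfun (cstr A) 0 0 (cstr B)\<rparr>"

definition Lambda :: "('v::real_normed_vector) torus \<Rightarrow> ('v \<times> ('v \<Rightarrow>\<^sub>L real)) set" where
  "Lambda A = lat (prod_torus A (dual_torus A))"

definition Q_form :: "'v::real_normed_vector \<times> ('v \<Rightarrow>\<^sub>L real) \<Rightarrow> 'v \<times> ('v \<Rightarrow>\<^sub>L real) \<Rightarrow> real" where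
  "Q_form x y = blinfun_apply (snd x) (fst y) + blinfun_apply (snd y) (fst x)"

definition NS :: "('v::real_normed_vector) torus \<Rightarrow> ('v \<Rightarrow>\<^sub>L 'v \<Rightarrow>\<^sub>L real) set" where
  "NS A = {c :: 'v \<Rightarrow>\<^sub>L 'v \<Rightarrow>\<^sub>L real. (\<forall>v w. c v w = - c w v) \<and> (\<forall>x\<in>lat A. \<forall>y\<in>lat A. c x y \<in> \<int>) \<and>
              (\<forall>v w. c (cstr A v) (cstr A w) = c v w)}"

text \<open>
  \<open>NS \<otimes> \<real>\<close> is the real span of \<open>NS\<close> (forms that are integral on a lattice are linearly
  independent over \<open>\<real>\<close> as soon as they are so over \<open>\<int>\<close>); the pair \<open>(\<phi>1, \<phi>2)\<close> stands for
  \<open>\<phi>1 + i \<phi>2\<close>.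
\<close>

definition NS_C0 ::
    "('v::real_normed_vector) torus \<Rightarrow> (('v \<Rightarrow>\<^sub>L 'v \<Rightarrow>\<^sub>L real) \<times> ('v \<Rightarrow>\<^sub>L 'v \<Rightarrow>\<^sub>L real)) set" where
  "NS_C0 A = {(\<phi>1, \<phi>2). \<phi>1 \<in> span (NS A) \<and> \<phi>2 \<in> span (NS A) \<and> nondegenerate_form \<phi>2}"

definition I_cstr ::
    "('v::real_normed_vector \<Rightarrow>\<^sub>L 'v \<Rightarrow>\<^sub>L real) \<times> ('v \<Rightarrow>\<^sub>L 'v \<Rightarrow>\<^sub>L real) \<Rightarrow>
     (('v \<times> ('v \<Rightarrow>\<^sub>L real)) \<Rightarrow>\<^sub>L ('v \<times> ('v \<Rightarrow>\<^sub>L real)))" where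
  "I_cstr \<omega> = matrix_cstr (fst \<omega>) (snd \<omega>)"

definition weak_pair ::
    "('v::real_normed_vector) torus \<times> (('v \<Rightarrow>\<^sub>L 'v \<Rightarrow>\<^sub>L real) \<times> ('v \<Rightarrow>\<^sub>L 'v \<Rightarrow>\<^sub>L real)) \<Rightarrow> bool" where
  "weak_pair P \<longleftrightarrow> complex_torus (fst P) \<and> snd P \<in> NS_C0 (fst P)"

definition mirror_symmetric ::
    "('v::real_normed_vector) torus \<times> (('v \<Rightarrow>\<^sub>L 'v \<Rightarrow>\<^sub>L real) \<times> ('v \<Rightarrow>\<^sub>L 'v \<Rightarrow>\<^sub>L real)) \<Rightarrow>
     ('w::real_normed_vector) torus \<times> (('w \<Rightarrow>\<^sub>L 'w \<Rightarrow>\<^sub>L real) \<times> ('w \<Rightarrow>\<^sub>L 'w \<Rightarrow>\<^sub>L real)) \<Rightarrow> bool" where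
  "mirror_symmetric P P' \<longleftrightarrow> weak_pair P \<and> weak_pair P' \<and>
     (let A = fst P; \<omega> = snd P; B = fst P'; \<eta> = snd P' in
       \<exists>\<alpha> :: ('v \<times> ('v \<Rightarrow>\<^sub>L real)) \<Rightarrow>\<^sub>L ('w \<times> ('w \<Rightarrow>\<^sub>L real)).
         bij_betw (blinfun_apply \<alpha>) (Lambda A) (Lambda B) \<and>
         (\<forall>x\<in>Lambda A. \<forall>y\<in>Lambda A. Q_form (\<alpha> x) (\<alpha> y) = Q_form x y) \<and>
         \<alpha> o\<^sub>L cstr (prod_torus A (dual_torus A)) = I_cstr \<eta> o\<^sub>L \<alpha> \<and>
         \<alpha> o\<^sub>L I_cstr \<omega> = cstr (prod_torus B (dual_torus B)) o\<^sub>L \<alpha>)"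


subsection \<open>The G-construction\<close>

text \<open>A \<open>\<rat>\<close>-algebra structure on the whole type \<open>'d\<close>, given by its scalar multiplication.\<close>

definition fin_dim_rat_algebra :: "(rat \<Rightarrow> 'd::ring_1 \<Rightarrow> 'd) \<Rightarrow> bool" where
  "fin_dim_rat_algebra sc \<longleftrightarrow>
     (\<exists>B. finite_dimensional_vector_space sc B) \<and>
     (\<forall>r a b. sc r (a * b) = sc r a * b \<and> sc r (a * b) = a * sc r b)"

definition is_order :: "(rat \<Rightarrow> 'd::ring_1 \<Rightarrow> 'd) \<Rightarrow> 'd set \<Rightarrow> bool" where
  "is_order sc R \<longleftrightarrow>
     1 \<in> R \<and> (\<forall>a\<in>R. \<forall>b\<in>R. a * b \<in> R) \<and>
     (\<exists>B. finite B \<and> R = {\<Sum>b\<in>B. of_int (k b) * b | k. True}) \<and>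
     module.span sc R = UNIV"

text \<open>
  The action of the rational algebra \<open>D\<close> on \<open>\<Gamma> \<otimes> \<rat>\<close> induced by an \<open>R\<close>-module structure on \<open>\<Gamma>\<close>,
  extended to \<open>\<Gamma> \<otimes> \<real>\<close>.
\<close>

definition lattice_module ::
    "'d::ring_1 set \<Rightarrow> ('d \<Rightarrow> ('m::real_normed_vector \<Rightarrow>\<^sub>L 'm)) \<Rightarrow> 'm set \<Rightarrow> bool" where
  "lattice_module R \<rho> \<Gamma> \<longleftrightarrow>
     full_lattice \<Gamma> \<and> \<rho> 1 = id_blinfun \<and>
     (\<forall>a b. \<rho> (a + b) = \<rho> a + \<rho> b) \<and> (\<forall>a b. \<rho> (a * b) = \<rho> a o\<^sub>L \<rho> b) \<and>
     (\<forall>a\<in>R. blinfun_apply (\<rho> a) ` \<Gamma> \<subseteq> \<Gamma>)"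

definition g_adjoint ::
    "('m::real_normed_vector \<Rightarrow>\<^sub>L 'm \<Rightarrow>\<^sub>L real) \<Rightarrow> ('m \<Rightarrow>\<^sub>L 'm) \<Rightarrow> ('m \<Rightarrow>\<^sub>L 'm)" where
  "g_adjoint g a = inv_blinfun g o\<^sub>L transpose_blinfun a o\<^sub>L g"

definition End_D ::
    "('d \<Rightarrow> ('m::real_normed_vector \<Rightarrow>\<^sub>L 'm)) \<Rightarrow> 'm set \<Rightarrow> ('m \<Rightarrow>\<^sub>L 'm) set" where
  "End_D \<rho> M = {c. blinfun_apply c ` M \<subseteq> M \<and> (\<forall>a. c o\<^sub>L \<rho> a = \<rho> a o\<^sub>L c)}"

definition S_sym ::
    "('m::real_normed_vector \<Rightarrow>\<^sub>L 'm \<Rightarrow>\<^sub>L real) \<Rightarrow> ('m \<Rightarrow>\<^sub>L 'm) set \<Rightarrow> ('m \<Rightarrow>\<^sub>L 'm) set" where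
  "S_sym g C = {c \<in> C. g_adjoint g c = c}"

definition diag_action ::
    "('d \<Rightarrow> ('m::real_normed_vector \<Rightarrow>\<^sub>L 'm)) \<Rightarrow> ('d \<Rightarrow> ('n::real_normed_vector \<Rightarrow>\<^sub>L 'n)) \<Rightarrow>
     'd \<Rightarrow> (('m \<times> 'n) \<Rightarrow>\<^sub>L ('m \<times> 'n))" where
  "diag_action \<rho>1 \<rho>2 a = block_blinfun (\<rho>1 a) 0 0 (\<rho>2 a)"

text \<open>
  The direct sum \<open>\<Gamma> = \<Gamma>\<^sub>1 \<oplus> \<Gamma>\<^sub>2\<close> is \<open>\<Gamma>1 \<times> \<Gamma>2\<close> with the diagonal action.  The module \<open>M\<close> is
  taken to be \<open>M\<^sub>1 = \<Gamma>\<^sub>1 \<otimes> \<rat>\<close>, and \<open>M\<^sub>2\<close> is identified with it by \<open>e\<close>.  The rank of \<open>\<Gamma>\<close> is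
  even because \<open>e\<close> forces \<open>\<Gamma>\<^sub>1\<close> and \<open>\<Gamma>\<^sub>2\<close> to have the same rank.
\<close>

locale G_construction =
  fixes sc :: "rat \<Rightarrow> 'd::ring_1 \<Rightarrow> 'd"
    and R :: "'d set"
    and \<rho>1 :: "'d \<Rightarrow> ('m::euclidean_space \<Rightarrow>\<^sub>L 'm)"
    and \<rho>2 :: "'d \<Rightarrow> ('n::euclidean_space \<Rightarrow>\<^sub>L 'n)"
    and \<Gamma>1 :: "'m set"
    and \<Gamma>2 :: "'n set"
    and e :: "'m \<Rightarrow>\<^sub>L 'n"
    and g :: "'m \<Rightarrow>\<^sub>L 'm \<Rightarrow>\<^sub>L real"
  assumes algebra: "fin_dim_rat_algebra sc"
    and order: "is_order sc R"
    and module1: "lattice_module R \<rho>1 \<Gamma>1"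
    and module2: "lattice_module R \<rho>2 \<Gamma>2"
    and faithful: "\<And>a b. a \<in> R \<Longrightarrow> b \<in> R \<Longrightarrow>
          (\<forall>x\<in>\<Gamma>1 \<times> \<Gamma>2. diag_action \<rho>1 \<rho>2 a x = diag_action \<rho>1 \<rho>2 b x) \<Longrightarrow> a = b"
    and saturated: "{a. blinfun_apply (diag_action \<rho>1 \<rho>2 a) ` (\<Gamma>1 \<times> \<Gamma>2) \<subseteq> \<Gamma>1 \<times> \<Gamma>2} = R"
    and iso_bij: "bij_betw (blinfun_apply e) (rational_span \<Gamma>1) (rational_span \<Gamma>2)"
    and iso_equivariant: "\<And>a. e o\<^sub>L \<rho>1 a = \<rho>2 a o\<^sub>L e"
    and g_rational: "\<And>x y. x \<in> rational_span \<Gamma>1 \<Longrightarrow> y \<in> rational_span \<Gamma>1 \<Longrightarrow> g x y \<in> \<rat>"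
    and g_symmetric: "\<And>x y. g x y = g y x"
    and g_nondegenerate: "nondegenerate_form g"
    and g_invariant: "g_adjoint g ` range \<rho>1 \<subseteq> range \<rho>1"

text \<open>\<open>S(C) \<otimes> \<real>\<close>, where \<open>C = End\<^sub>D(M)\<close>.\<close>

definition SC_real ::
    "('d \<Rightarrow> ('m::real_normed_vector \<Rightarrow>\<^sub>L 'm)) \<Rightarrow> 'm set \<Rightarrow> ('m \<Rightarrow>\<^sub>L 'm \<Rightarrow>\<^sub>L real) \<Rightarrow> ('m \<Rightarrow>\<^sub>L 'm) set" where
  "SC_real \<rho>1 \<Gamma>1 g = span (S_sym g (End_D \<rho>1 (rational_span \<Gamma>1)))"

text \<open>
  \<open>A\<^bsub>J(q)\<^esub>\<close> for \<open>q = q1 + i q2\<close>; the matrix \<open>J(q)\<close> on \<open>(M \<oplus> M) \<otimes> \<real>\<close> is transported to \<open>\<Gamma> \<otimes> \<real>\<close> by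
  \<open>id \<oplus> e\<close>.
\<close>

definition G_torus ::
    "'m::real_normed_vector set \<Rightarrow> 'n::real_normed_vector set \<Rightarrow> ('m \<Rightarrow>\<^sub>L 'n) \<Rightarrow>
     ('m \<Rightarrow>\<^sub>L 'm) \<Rightarrow> ('m \<Rightarrow>\<^sub>L 'm) \<Rightarrow> ('m \<times> 'n) torus" where
  "G_torus \<Gamma>1 \<Gamma>2 e q1 q2 =
     (let E = block_blinfun id_blinfun 0 0 e in
       \<lparr>lat = \<Gamma>1 \<times> \<Gamma>2, cstr = E o\<^sub>L matrix_cstr q1 q2 o\<^sub>L inv_blinfun E\<rparr>)"

end

theory Submission
  imports Defs
begin

text \<open>
  The idea is that mirror symmetry exchanges the parameter \<open>q\<close> of the G-construction with the
  polarization datum \<open>\<omega>\<close>.  Write \<open>V = M \<oplus> N\<close> for the two real summands, and let \<open>G : M \<rightarrow> N\<close> be the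
  isomorphism with \<open>\<langle>G x, e y\<rangle> = g x y\<close>, where \<open>\<langle>\<cdot>, \<cdot>\<rangle>\<close> is the inner product of \<open>N\<close>.  That inner product
  is auxiliary: it only serves to realize the dual of \<open>N\<close>, and with it the dual lattice \<open>\<Gamma>2\<^sup>*\<close>, inside \<open>N\<close>
  itself, so that \<open>G\<close> becomes a map \<open>M \<rightarrow> N\<^sup>*\<close> of the same shape as \<open>e : M \<rightarrow> N\<close>.  Every \<open>u : M \<rightarrow> N\<close>
  defines the skew form \<open>skew_form u\<close> on \<open>M \<oplus> N\<close> that pairs \<open>M\<close> with \<open>N\<close> through \<open>u\<close> and vanishes on
  each summand.

  The form \<open>skew_form G\<close> is rational, nondegenerate and invariant under \<open>J(q)\<close>, because \<open>q\<close> is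
  symmetric with respect to \<open>g\<close>.  Hence every class \<open>c\<close> in the Neron-Severi group is
  \<open>skew_form G (h \<cdot>) \<cdot>\<close> for a rational endomorphism \<open>h\<close> of the torus.  As \<open>End(A) = R\<close>, \<open>h\<close> is a rational
  multiple of the diagonal action of an element of \<open>R\<close>, and the skew symmetry of \<open>c\<close> says that this
  action is \<open>g\<close>-symmetric (\<open>NS_G_torus\<close>).  Therefore \<open>\<omega> = (skew_form (G t1), skew_form (G t2))\<close> for
  \<open>g\<close>-symmetric operators \<open>t1, t2\<close> on \<open>M\<close> that commute with \<open>S(C)\<close>.

  All blocks of \<open>\<omega>\<close> are off-diagonal, so \<open>I\<^sub>\<omega>\<close> preserves the decomposition of \<open>V \<oplus> V\<^sup>*\<close> into
  \<open>M \<oplus> N\<^sup>*\<close> and \<open>M\<^sup>* \<oplus> N\<close>, two isotropic subspaces for \<open>Q\<close> that are dual to each other.  On the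
  first of them \<open>I\<^sub>\<omega>\<close> is given by the very formula of the G-construction, with \<open>(G, t)\<close> in place of
  \<open>(e, q)\<close>.  So the mirror torus is \<open>B = G_torus \<Gamma>1 \<Gamma>2\<^sup>* G t1 t2\<close>, and \<open>\<alpha>\<close> is the map \<open>half_swap\<close> that
  exchanges \<open>N\<close> with \<open>N\<^sup>*\<close>.  The statement that \<open>half_swap\<close> carries \<open>I\<^sub>\<omega>\<close> to the complex structure of
  the product of \<open>B\<close> and its dual (\<open>half_swap_intertwines\<close>) applies equally to \<open>(e, q)\<close>, and as
  \<open>half_swap\<close> is an involution, this second instance shows that the complex structure of the product
  of \<open>A\<close> and its dual is carried to \<open>I\<^sub>\<eta>\<close> for \<open>\<eta> = (skew_form (e q1), skew_form (e q2))\<close>.  Finally, \<open>\<eta>\<close>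
  lies in the Neron-Severi space of \<open>B\<close>: for \<open>q\<close> in \<open>S(C)\<close> the form \<open>skew_form (e q)\<close> is rational on
  \<open>\<Gamma>1 \<oplus> \<Gamma>2\<^sup>*\<close>, and it is invariant because \<open>q\<close> commutes with \<open>t1\<close> and \<open>t2\<close> (\<open>skew_form_invariant\<close>).
\<close>

section \<open>Invertible operators and the Riesz isomorphism\<close>

lemma inv_blinfun_unique:
  assumes "h o\<^sub>L f = id_blinfun" and "f o\<^sub>L h = id_blinfun"
  shows "inv_blinfun f = h"
  unfolding inv_blinfun_def
proof (rule the_equality)
  show "h o\<^sub>L f = id_blinfun \<and> f o\<^sub>L h = id_blinfun"
    using assms by simp
next
  fix k assume k: "k o\<^sub>L f = id_blinfun \<and> f o\<^sub>L k = id_blinfun"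
  have *: "f (h y) = y" "k (f x) = x" for x y
    using assms(2) k by (metis blinfun_apply_blinfun_compose blinfun_apply_id_blinfun)+
  show "k = h"
    by (rule blinfun_eqI) (metis *)
qed

lemma
  assumes "invertible_blinfun f"
  shows inv_blinfun_left [simp]: "inv_blinfun f (f x) = x"
    and inv_blinfun_right [simp]: "f (inv_blinfun f y) = y"
proof -
  obtain h where h: "h o\<^sub>L f = id_blinfun" "f o\<^sub>L h = id_blinfun"
    using assms unfolding invertible_blinfun_def by blast
  then have eq: "inv_blinfun f = h"
    by (rule inv_blinfun_unique)
  show "inv_blinfun f (f x) = x" "f (inv_blinfun f y) = y"
    unfolding eq using h by (metis blinfun_apply_blinfun_compose blinfun_apply_id_blinfun)+
qed

lemma invertible_blinfunI:
  assumes "\<And>x. blinfun_apply h (blinfun_apply f x) = x"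
    and "\<And>y. blinfun_apply f (blinfun_apply h y) = y"
  shows "invertible_blinfun f"
  unfolding invertible_blinfun_def
  by (rule exI[of _ h]) (auto intro!: blinfun_eqI simp: assms)

lemma inv_blinfun_eqI:
  assumes "\<And>x. blinfun_apply h (blinfun_apply f x) = x"
    and "\<And>y. blinfun_apply f (blinfun_apply h y) = y"
  shows "inv_blinfun f = h"
  by (rule inv_blinfun_unique) (auto intro!: blinfun_eqI simp: assms)

lemma invertible_blinfun_compose:
  assumes "invertible_blinfun f" and "invertible_blinfun h"
  shows "invertible_blinfun (f o\<^sub>L h)"
  by (rule invertible_blinfunI[of "inv_blinfun h o\<^sub>L inv_blinfun f"]) (simp_all add: assms)

lemma invertible_blinfun_inj:
  assumes "invertible_blinfun f" and "blinfun_apply f x = blinfun_apply f y"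
  shows "x = y"
  using assms by (metis inv_blinfun_left)

lemma transpose_blinfun_apply [simp]:
  "blinfun_apply (blinfun_apply (transpose_blinfun f) w) x = blinfun_apply w (blinfun_apply f x)"
  by (simp add: transpose_blinfun.rep_eq)

lemma block_blinfun_apply [simp]:
  "blinfun_apply (block_blinfun a b c d) (x, y) =
     (blinfun_apply a x + blinfun_apply b y, blinfun_apply c x + blinfun_apply d y)"
  by (simp add: block_blinfun.rep_eq)

lemma invertible_blinfun_of_injective:
  fixes f :: "'a::euclidean_space \<Rightarrow>\<^sub>L 'a"
  assumes "\<And>x. blinfun_apply f x = 0 \<Longrightarrow> x = 0"
  shows "invertible_blinfun f"
proof -
  have lin: "linear (blinfun_apply f)"
    by (simp add: bounded_linear.linear blinfun.bounded_linear_right)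
  have "inj (blinfun_apply f)"
    using assms lin by (metis linear_injective_0)
  then obtain h where h: "linear h" "\<forall>x. h (f x) = x" "\<forall>x. f (h x) = x"
    using linear_injective_isomorphism[OF lin] by blast
  have "bounded_linear h"
    using h(1) by (simp add: linear_conv_bounded_linear)
  then show ?thesis
    using h by (intro invertible_blinfunI[of "Blinfun h"]) (simp_all add: bounded_linear_Blinfun_apply)
qed

lemma inner_eqI: "(\<And>z. x \<bullet> z = y \<bullet> z) \<Longrightarrow> x = y"
  using vector_eq_rdot by blast

text \<open>
  In coordinates given by the inner product, elements of \<open>V \<oplus> V\<^sup>*\<close> become pairs of vectors, and all
  computations with dual spaces below reduce to identities between inner products.
\<close>

definition riesz :: "'a::euclidean_space \<Rightarrow>\<^sub>L ('a \<Rightarrow>\<^sub>L real)" where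
  "riesz = Blinfun blinfun_inner_right"

definition riesz_inv :: "('a::euclidean_space \<Rightarrow>\<^sub>L real) \<Rightarrow>\<^sub>L 'a" where
  "riesz_inv = Blinfun (\<lambda>\<xi>. \<Sum>i\<in>Basis. blinfun_apply \<xi> i *\<^sub>R i)"

lemma riesz_apply [simp]: "blinfun_apply (blinfun_apply riesz u) x = u \<bullet> x"
  unfolding riesz_def
  by (simp add: bounded_linear_Blinfun_apply bounded_linear_blinfun_inner_right)

lemma riesz_inv_apply: "blinfun_apply riesz_inv \<xi> = (\<Sum>i\<in>Basis. \<xi> i *\<^sub>R i)"
  unfolding riesz_inv_def
  by (subst bounded_linear_Blinfun_apply)
     (auto intro!: bounded_linear_sum bounded_linear_scaleR_const blinfun.bounded_linear_left)

lemma riesz_inv_inner [simp]: "blinfun_apply riesz_inv \<xi> \<bullet> x = blinfun_apply \<xi> x"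
proof -
  have "blinfun_apply \<xi> x = blinfun_apply \<xi> (\<Sum>i\<in>Basis. (x \<bullet> i) *\<^sub>R i)"
    by (simp add: euclidean_representation)
  also have "\<dots> = blinfun_apply riesz_inv \<xi> \<bullet> x"
    by (simp add: riesz_inv_apply blinfun.bilinear_simps inner_sum_left inner_sum_right mult.commute
        blinfun.sum_right inner_commute)
  finally show ?thesis by simp
qed

lemma riesz_riesz_inv [simp]: "blinfun_apply riesz (blinfun_apply riesz_inv \<xi>) = \<xi>"
  by (rule blinfun_eqI) simp

lemma riesz_inv_riesz [simp]: "blinfun_apply riesz_inv (blinfun_apply riesz u) = u"
  by (rule inner_eqI) simp

lemma invertible_riesz: "invertible_blinfun riesz"
  by (rule invertible_blinfunI[of riesz_inv]) simp_all

lemma invertible_riesz_inv: "invertible_blinfun riesz_inv"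
  by (rule invertible_blinfunI[of riesz]) simp_all

text \<open>
  The Riesz isomorphism turns a form into an endomorphism of \<open>V\<close>, for which injectivity is enough by
  finite dimension.
\<close>

lemma invertible_nondegenerate_form:
  fixes c :: "'a::euclidean_space \<Rightarrow>\<^sub>L 'a \<Rightarrow>\<^sub>L real"
  assumes "nondegenerate_form c"
  shows "invertible_blinfun c"
proof -
  have "invertible_blinfun (riesz_inv o\<^sub>L c)"
  proof (rule invertible_blinfun_of_injective)
    fix x assume "blinfun_apply (riesz_inv o\<^sub>L c) x = 0"
    then have "\<And>w. c x w = 0"
      using riesz_inv_inner[of "c x"] by simp
    then show "x = 0"
      using assms unfolding nondegenerate_form_def by blast
  qed
  then have "invertible_blinfun (riesz o\<^sub>L (riesz_inv o\<^sub>L c))"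
    by (rule invertible_blinfun_compose[OF invertible_riesz])
  moreover have "riesz o\<^sub>L (riesz_inv o\<^sub>L c) = c"
    by (rule blinfun_eqI) simp
  ultimately show ?thesis by simp
qed

section \<open>Complex structures of block matrix form\<close>

text \<open>
  Naming the first component \<open>z\<close> removes most inverses: if \<open>\<phi>2\<close> is invertible, the structure sends
  \<open>(x, y)\<close> to \<open>(z, \<phi>2 x + \<phi>1 z)\<close> where \<open>z\<close> is the solution of \<open>\<phi>2 z = \<phi>1 x - y\<close>.
\<close>

lemma matrix_cstr_apply:
  "matrix_cstr \<phi>1 \<phi>2 (x, y) =
     (let z = inv_blinfun \<phi>2 (\<phi>1 x - y) in (z, \<phi>2 x + \<phi>1 z))"
  by (simp add: matrix_cstr_def Let_def blinfun.bilinear_simps)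

lemma lat_G_torus [simp]: "lat (G_torus \<Gamma>1 \<Gamma>2 e q1 q2) = \<Gamma>1 \<times> \<Gamma>2"
  by (simp add: G_torus_def Let_def)

text \<open>
  Writing the second argument as \<open>e y\<close> hides the transport by \<open>id \<oplus> e\<close>.
\<close>

lemma cstr_G_torus_apply:
  fixes e :: "'m::real_normed_vector \<Rightarrow>\<^sub>L 'n::real_normed_vector"
  assumes e: "invertible_blinfun e"
  shows "cstr (G_torus \<Gamma>1 \<Gamma>2 e q1 q2) (x, e y) =
     (let z = inv_blinfun q2 (q1 x - y) in (z, e (q2 x + q1 z)))"
proof -
  let ?E = "block_blinfun id_blinfun 0 0 e :: ('m \<times> 'm) \<Rightarrow>\<^sub>L ('m \<times> 'n)"
  have "inv_blinfun ?E = block_blinfun id_blinfun 0 0 (inv_blinfun e)"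
    by (rule inv_blinfun_eqI) (auto simp: e)
  then show ?thesis
    by (simp add: G_torus_def Let_def matrix_cstr_apply e)
qed

lemma cstr_G_torus_squared:
  fixes e :: "'a::real_normed_vector \<Rightarrow>\<^sub>L 'b::real_normed_vector"
  assumes e: "invertible_blinfun e" and q2: "invertible_blinfun q2"
  shows "cstr (G_torus \<Gamma>1 \<Gamma>2 e q1 q2) o\<^sub>L cstr (G_torus \<Gamma>1 \<Gamma>2 e q1 q2) = - id_blinfun"
proof (rule blinfun_eqI)
  fix v :: "'a \<times> 'b"
  obtain x y where v: "v = (x, e y)"
    using inv_blinfun_right[OF e] by (metis prod.exhaust)
  define z where "z = inv_blinfun q2 (q1 x - y)"
  have z: "q2 z = q1 x - y"
    by (simp add: z_def q2)
  have "inv_blinfun q2 (q1 z - (q2 x + q1 z)) = - x"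
    using q2 by (simp add: blinfun.bilinear_simps)
  then show "(cstr (G_torus \<Gamma>1 \<Gamma>2 e q1 q2) o\<^sub>L cstr (G_torus \<Gamma>1 \<Gamma>2 e q1 q2)) v = (- id_blinfun) v"
    by (simp add: v cstr_G_torus_apply e Let_def z_def[symmetric])
       (simp add: z blinfun.bilinear_simps)
qed

section \<open>Off-diagonal skew forms\<close>

text \<open>
  This is the pullback of the standard symplectic form of \<open>N \<oplus> N\<^sup>*\<close> under \<open>u \<oplus> id\<close>, with \<open>N\<close>
  identified with its dual.
\<close>

definition skew_form :: "('m::euclidean_space \<Rightarrow>\<^sub>L 'n::euclidean_space) \<Rightarrow>
    (('m \<times> 'n) \<Rightarrow>\<^sub>L ('m \<times> 'n) \<Rightarrow>\<^sub>L real)" where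
  "skew_form u =
     (transpose_blinfun snd_blinfun o\<^sub>L riesz o\<^sub>L u o\<^sub>L fst_blinfun) -
     (transpose_blinfun fst_blinfun o\<^sub>L transpose_blinfun u o\<^sub>L riesz o\<^sub>L snd_blinfun)"

lemma skew_form_apply [simp]:
  "skew_form u v w = u (fst v) \<bullet> snd w - u (fst w) \<bullet> snd v"
  by (simp add: skew_form_def blinfun.bilinear_simps inner_commute)

lemma skew_form_nondegenerate:
  assumes "invertible_blinfun u"
  shows "nondegenerate_form (skew_form u)"
  unfolding nondegenerate_form_def
proof (intro allI impI)
  fix v assume v: "\<forall>w. skew_form u v w = 0"
  have "u (fst v) \<bullet> u (fst v) = 0"
    using v[rule_format, of "(0, u (fst v))"] by simp
  then have "fst v = 0"
    using invertible_blinfun_inj[OF assms, of "fst v" 0] by simp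
  moreover have "snd v \<bullet> snd v = 0"
    using v[rule_format, of "(inv_blinfun u (snd v), 0)"] assms by simp
  ultimately show "v = 0"
    by (simp add: prod_eq_iff)
qed

lemma linear_skew_form_compose: "linear (\<lambda>t. skew_form (u o\<^sub>L t))"
  by (rule linearI) (auto intro!: blinfun_eqI simp: blinfun.bilinear_simps algebra_simps)

text \<open>
  With \<open>h x y = \<langle>G x, e y\<rangle>\<close> and second components written as \<open>G b\<close>, the form becomes
  \<open>h (q a) d - h (q c) b\<close>, the symplectic form on \<open>M \<oplus> M\<close> defined by the symmetric form \<open>h (q \<cdot>) \<cdot>\<close>.  Since
  \<open>t1\<close> and \<open>t2\<close> commute with \<open>q\<close> and are \<open>h\<close>-symmetric, they are also symmetric for \<open>h (q \<cdot>) \<cdot>\<close>, and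
  then the matrix \<open>J(t)\<close> is symplectic.
\<close>

lemma skew_form_invariant:
  fixes G e :: "'m::euclidean_space \<Rightarrow>\<^sub>L 'n::euclidean_space" and q t1 t2 :: "'m \<Rightarrow>\<^sub>L 'm"
  assumes G: "invertible_blinfun G" and t2: "invertible_blinfun t2"
    and sym: "\<And>x y. G x \<bullet> e y = G y \<bullet> e x"
    and t1s: "\<And>x y. G (t1 x) \<bullet> e y = G x \<bullet> e (t1 y)"
    and t2s: "\<And>x y. G (t2 x) \<bullet> e y = G x \<bullet> e (t2 y)"
    and qs: "\<And>x y. G (q x) \<bullet> e y = G x \<bullet> e (q y)"
    and c1: "q o\<^sub>L t1 = t1 o\<^sub>L q" and c2: "q o\<^sub>L t2 = t2 o\<^sub>L q"
  shows "skew_form (e o\<^sub>L q) (cstr (G_torus L1 L2 G t1 t2) v) (cstr (G_torus L1 L2 G t1 t2) w) =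
         skew_form (e o\<^sub>L q) v w"
proof -
  obtain a b where v: "v = (a, G b)"
    by (metis inv_blinfun_right[OF G] prod.exhaust)
  obtain c d where w: "w = (c, G d)"
    by (metis inv_blinfun_right[OF G] prod.exhaust)
  define y where "y = inv_blinfun t2 (t1 a - b)"
  define z where "z = inv_blinfun t2 (t1 c - d)"
  have y: "t2 y = t1 a - b" and z: "t2 z = t1 c - d"
    by (simp_all add: y_def z_def t2)
  define h where "h x x' = G x \<bullet> e x'" for x x'
  have h_add: "h (x + x') k = h x k + h x' k" "h (x - x') k = h x k - h x' k" for x x' k
    by (simp_all add: h_def blinfun.bilinear_simps inner_add_left inner_diff_left)
  have hs: "h x x' = h x' x" "h (t1 x) x' = h x (t1 x')" "h (t2 x) x' = h x (t2 x')"
    "h (q x) x' = h x (q x')" for x x'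
    unfolding h_def using sym t1s t2s qs by blast+
  have c: "q (t1 x) = t1 (q x)" "q (t2 x) = t2 (q x)" for x
    using c1 c2 by (metis blinfun_apply_blinfun_compose)+
  \<comment> \<open>The forms \<open>h k (q l)\<close> and \<open>h (t1 k) (q l)\<close> are symmetric in \<open>k\<close> and \<open>l\<close>.\<close>
  have swap: "h k (q l) = h l (q k)" for k l
    using hs(4)[of k l] hs(1)[of "q k" l] by simp
  have swap1: "h (t1 k) (q l) = h (t1 l) (q k)" for k l
    using swap[of "t1 k" l] hs(2)[of l "q k"] by (simp add: c)
  have "h (t2 a + t1 y) (q z) - h (t2 c + t1 z) (q y) =
        h a (q (t2 z)) - h c (q (t2 y))"
    using swap1[of y z] by (simp add: h_add hs(3) c)
  also have "\<dots> = h (t2 z) (q a) - h (t2 y) (q c)"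
    using swap[of a "t2 z"] swap[of c "t2 y"] by simp
  also have "\<dots> = h b (q c) - h d (q a)"
    using swap1[of a c] by (simp add: y z h_add)
  finally have "h (t2 c + t1 z) (q y) - h (t2 a + t1 y) (q z) = h d (q a) - h b (q c)"
    by simp
  moreover have "cstr (G_torus L1 L2 G t1 t2) v = (y, G (t2 a + t1 y))"
    "cstr (G_torus L1 L2 G t1 t2) w = (z, G (t2 c + t1 z))"
    by (simp_all add: v w cstr_G_torus_apply G Let_def y_def z_def)
  ultimately show ?thesis
    by (simp add: v w h_def inner_commute)
qed

section \<open>Lattices, dual lattices and rationality\<close>

definition dual_lattice :: "'a::euclidean_space set \<Rightarrow> 'a set" where
  "dual_lattice \<Gamma> = {x. \<forall>y\<in>\<Gamma>. x \<bullet> y \<in> \<int>}"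

text \<open>
  A basis \<open>B\<close> of a lattice together with its dual basis \<open>d\<close> with respect to the inner product.  The
  coordinate functionals \<open>d b \<bullet> \<cdot>\<close> make membership in the lattice and in its rational span a condition on
  finitely many numbers, and passing to the dual lattice amounts to exchanging \<open>B\<close> with \<open>d\<close>.
\<close>

definition lattice_basis :: "'a::euclidean_space set \<Rightarrow> ('a \<Rightarrow> 'a) \<Rightarrow> 'a set \<Rightarrow> bool" where
  "lattice_basis B d \<Gamma> \<longleftrightarrow> finite B \<and>
     (\<forall>b\<in>B. \<forall>b'\<in>B. d b \<bullet> b' = (if b = b' then 1 else 0)) \<and>
     (\<forall>v. (\<Sum>b\<in>B. (d b \<bullet> v) *\<^sub>R b) = v) \<and>
     \<Gamma> = {v. \<forall>b\<in>B. d b \<bullet> v \<in> \<int>}"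

lemma biorthogonal_coord_sum:
  fixes d :: "'a::real_inner \<Rightarrow> 'a"
  assumes "finite B" and "b \<in> B"
    and "\<And>b'. b' \<in> B \<Longrightarrow> d b \<bullet> b' = (if b = b' then 1 else 0)"
  shows "d b \<bullet> (\<Sum>b'\<in>B. k b' *\<^sub>R b') = k b"
proof -
  have "d b \<bullet> (\<Sum>b'\<in>B. k b' *\<^sub>R b') = (\<Sum>b'\<in>B. if b = b' then k b' else 0)"
    unfolding inner_sum_right by (intro sum.cong) (auto simp: assms(3))
  with assms show ?thesis by simp
qed

lemma lattice_basis_coord_sum:
  assumes "lattice_basis B d \<Gamma>" and "b \<in> B"
  shows "d b \<bullet> (\<Sum>b'\<in>B. k b' *\<^sub>R b') = k b"
  using assms by (intro biorthogonal_coord_sum) (auto simp: lattice_basis_def)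

lemma full_lattice_imp_basis:
  fixes \<Gamma> :: "'a::euclidean_space set"
  assumes "full_lattice \<Gamma>"
  obtains B d where "lattice_basis B d \<Gamma>"
proof -
  obtain B where B: "finite B" "independent B" "span B = UNIV"
    and \<Gamma>: "\<Gamma> = {\<Sum>b\<in>B. of_int (k b) *\<^sub>R b | k. True}"
    using assms unfolding full_lattice_def by blast
  define d where "d b = (\<Sum>i\<in>Basis. representation B i b *\<^sub>R i)" for b
  have d: "d b \<bullet> v = representation B v b" for b v
  proof -
    have "representation B (\<Sum>i\<in>Basis. (v \<bullet> i) *\<^sub>R i) b
        = (\<Sum>i\<in>Basis. (v \<bullet> i) * representation B i b)"
      using B by (simp add: representation_sum representation_scale)
    then show ?thesis
      unfolding euclidean_representation d_def
      by (simp add: inner_sum_left inner_sum_right inner_commute[of _ v] mult.commute)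
  qed
  have biorth: "d b \<bullet> b' = (if b = b' then 1 else 0)" if "b \<in> B" "b' \<in> B" for b b'
    using that B by (auto simp: d representation_basis)
  have exp: "(\<Sum>b\<in>B. (d b \<bullet> v) *\<^sub>R b) = v" for v
    using B by (simp add: d sum_representation_eq)
  have coord: "d b \<bullet> (\<Sum>b'\<in>B. k b' *\<^sub>R b') = k b" if "b \<in> B" for b k
    using that by (intro biorthogonal_coord_sum B(1) biorth)
  have "\<Gamma> = {v. \<forall>b\<in>B. d b \<bullet> v \<in> \<int>}"
  proof (intro equalityI subsetI)
    fix v assume "v \<in> \<Gamma>"
    then show "v \<in> {v. \<forall>b\<in>B. d b \<bullet> v \<in> \<int>}"
      by (auto simp: \<Gamma> coord)
  next
    fix v assume "v \<in> {v. \<forall>b\<in>B. d b \<bullet> v \<in> \<int>}"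
    then have "\<forall>b\<in>B. d b \<bullet> v = of_int \<lfloor>d b \<bullet> v\<rfloor>"
      by simp
    then have "(\<Sum>b\<in>B. of_int \<lfloor>d b \<bullet> v\<rfloor> *\<^sub>R b) = (\<Sum>b\<in>B. (d b \<bullet> v) *\<^sub>R b)"
      by (intro sum.cong) auto
    then have "v = (\<Sum>b\<in>B. of_int \<lfloor>d b \<bullet> v\<rfloor> *\<^sub>R b)"
      using exp by simp
    then show "v \<in> \<Gamma>"
      unfolding \<Gamma> by (auto intro!: exI[of _ "\<lambda>b. \<lfloor>d b \<bullet> v\<rfloor>"])
  qed
  with B(1) biorth exp have "lattice_basis B d \<Gamma>"
    unfolding lattice_basis_def by blast
  then show thesis by (rule that)
qed

lemma lattice_basis_imp_full:
  fixes \<Gamma> :: "'a::euclidean_space set"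
  assumes "lattice_basis B d \<Gamma>"
  shows "full_lattice \<Gamma>"
proof -
  have B: "finite B" and exp: "\<And>v. (\<Sum>b\<in>B. (d b \<bullet> v) *\<^sub>R b) = v"
    and \<Gamma>: "\<Gamma> = {v. \<forall>b\<in>B. d b \<bullet> v \<in> \<int>}"
    using assms unfolding lattice_basis_def by blast+
  note coord = lattice_basis_coord_sum[OF assms]
  have "independent B"
  proof (rule independent_if_scalars_zero[OF B])
    fix k b assume "(\<Sum>b\<in>B. k b *\<^sub>R b) = 0" "b \<in> B"
    then show "k b = 0"
      using coord[of b k] by simp
  qed
  moreover have "span B = UNIV"
  proof -
    have "v \<in> span B" for v
      by (subst exp[of v, symmetric]) (intro span_sum span_scale span_base)
    then show ?thesis by blast
  qed
  moreover have "\<Gamma> = {\<Sum>b\<in>B. of_int (k b) *\<^sub>R b | k. True}"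
  proof (intro equalityI subsetI)
    fix v assume "v \<in> {\<Sum>b\<in>B. of_int (k b) *\<^sub>R b | k. True}"
    then show "v \<in> \<Gamma>"
      by (auto simp: \<Gamma> coord)
  next
    fix v assume "v \<in> \<Gamma>"
    then have "\<forall>b\<in>B. d b \<bullet> v = of_int \<lfloor>d b \<bullet> v\<rfloor>"
      by (simp add: \<Gamma>)
    then have "(\<Sum>b\<in>B. of_int \<lfloor>d b \<bullet> v\<rfloor> *\<^sub>R b) = (\<Sum>b\<in>B. (d b \<bullet> v) *\<^sub>R b)"
      by (intro sum.cong) auto
    then have "v = (\<Sum>b\<in>B. of_int \<lfloor>d b \<bullet> v\<rfloor> *\<^sub>R b)"
      using exp by simp
    then show "v \<in> {\<Sum>b\<in>B. of_int (k b) *\<^sub>R b | k. True}"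
      by (auto intro!: exI[of _ "\<lambda>b. \<lfloor>d b \<bullet> v\<rfloor>"])
  qed
  ultimately show ?thesis
    unfolding full_lattice_def using B by blast
qed

lemma lattice_basis_mem:
  assumes "lattice_basis B d \<Gamma>" and "b \<in> B"
  shows "b \<in> \<Gamma>"
  using assms by (auto simp: lattice_basis_def)

lemma lattice_basis_dual_mem:
  assumes "lattice_basis B d \<Gamma>" and "b \<in> B"
  shows "d b \<in> dual_lattice \<Gamma>"
  using assms by (auto simp: lattice_basis_def dual_lattice_def)

text \<open>
  The expansion of \<open>v\<close> in the dual basis is the expansion of an arbitrary \<open>w\<close> in \<open>B\<close>, read in the inner
  product \<open>v \<bullet> w\<close>.
\<close>

lemma lattice_basis_dual:
  assumes "lattice_basis B d \<Gamma>"
  shows "lattice_basis (d ` B) (inv_into B d) (dual_lattice \<Gamma>)"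
proof -
  have B: "finite B" and exp: "\<And>v. (\<Sum>b\<in>B. (d b \<bullet> v) *\<^sub>R b) = v"
    and \<Gamma>: "\<Gamma> = {v. \<forall>b\<in>B. d b \<bullet> v \<in> \<int>}"
    and bi: "\<And>b b'. b \<in> B \<Longrightarrow> b' \<in> B \<Longrightarrow> d b \<bullet> b' = (if b = b' then 1 else 0)"
    using assms unfolding lattice_basis_def by blast+
  have inj: "inj_on d B"
  proof (rule inj_onI)
    fix b b' assume "b \<in> B" "b' \<in> B" "d b = d b'"
    then show "b = b'"
      using bi[of b b'] bi[of b' b'] by (simp split: if_splits)
  qed
  have inner: "v \<bullet> w = (\<Sum>b\<in>B. (b \<bullet> v) * (d b \<bullet> w))" for v w
    by (subst exp[of w, symmetric]) (simp add: inner_sum_right inner_commute mult.commute)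
  have "(\<Sum>c\<in>d ` B. (inv_into B d c \<bullet> v) *\<^sub>R c) = v" for v
  proof (rule vector_eq_rdot[THEN iffD1], rule allI)
    fix w
    have "(\<Sum>c\<in>d ` B. (inv_into B d c \<bullet> v) *\<^sub>R c) \<bullet> w = (\<Sum>b\<in>B. (b \<bullet> v) * (d b \<bullet> w))"
      using inj by (simp add: sum.reindex inner_sum_left)
    then show "(\<Sum>c\<in>d ` B. (inv_into B d c \<bullet> v) *\<^sub>R c) \<bullet> w = v \<bullet> w"
      by (simp add: inner[of v w])
  qed
  moreover have "dual_lattice \<Gamma> = {v. \<forall>c\<in>d ` B. inv_into B d c \<bullet> v \<in> \<int>}"
  proof (intro equalityI subsetI)
    fix v assume "v \<in> dual_lattice \<Gamma>"
    then show "v \<in> {v. \<forall>c\<in>d ` B. inv_into B d c \<bullet> v \<in> \<int>}"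
      using inj lattice_basis_mem[OF assms] by (auto simp: dual_lattice_def inner_commute)
  next
    fix v assume "v \<in> {v. \<forall>c\<in>d ` B. inv_into B d c \<bullet> v \<in> \<int>}"
    then show "v \<in> dual_lattice \<Gamma>"
      using inj unfolding dual_lattice_def \<Gamma>
      by (auto simp: inner[of v] intro!: Ints_sum Ints_mult)
  qed
  moreover have "inv_into B d c \<bullet> c' = (if c = c' then 1 else 0)" if "c \<in> d ` B" "c' \<in> d ` B" for c c'
    using that inj bi by (auto simp: inner_commute inj_on_eq_iff)
  ultimately show ?thesis
    using B unfolding lattice_basis_def by blast
qed

lemma full_lattice_dual:
  assumes "full_lattice \<Gamma>"
  shows "full_lattice (dual_lattice \<Gamma>)"
proof -
  obtain B d where "lattice_basis B d \<Gamma>"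
    using assms by (rule full_lattice_imp_basis)
  then show ?thesis
    by (rule lattice_basis_imp_full[OF lattice_basis_dual])
qed

lemma double_dual_lattice:
  assumes "full_lattice \<Gamma>"
  shows "dual_lattice (dual_lattice \<Gamma>) = \<Gamma>"
proof
  show "\<Gamma> \<subseteq> dual_lattice (dual_lattice \<Gamma>)"
    by (auto simp: dual_lattice_def inner_commute)
  obtain B d where Bd: "lattice_basis B d \<Gamma>"
    using assms by (rule full_lattice_imp_basis)
  have \<Gamma>: "\<Gamma> = {v. \<forall>b\<in>B. d b \<bullet> v \<in> \<int>}"
    using Bd unfolding lattice_basis_def by blast
  show "dual_lattice (dual_lattice \<Gamma>) \<subseteq> \<Gamma>"
  proof
    fix v assume v: "v \<in> dual_lattice (dual_lattice \<Gamma>)"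
    have "d b \<bullet> v \<in> \<int>" if "b \<in> B" for b
    proof -
      have "\<forall>y\<in>dual_lattice \<Gamma>. v \<bullet> y \<in> \<int>"
        using v by (subst (asm) dual_lattice_def) simp
      then show ?thesis
        using lattice_basis_dual_mem[OF Bd that] by (metis inner_commute)
    qed
    then show "v \<in> \<Gamma>"
      unfolding \<Gamma> by blast
  qed
qed

lemma full_lattice_Times:
  fixes \<Gamma>1 :: "'a::euclidean_space set" and \<Gamma>2 :: "'b::euclidean_space set"
  assumes "full_lattice \<Gamma>1" and "full_lattice \<Gamma>2"
  shows "full_lattice (\<Gamma>1 \<times> \<Gamma>2)"
proof -
  obtain B1 d1 where 1: "lattice_basis B1 d1 \<Gamma>1"
    using assms(1) by (rule full_lattice_imp_basis)
  obtain B2 d2 where 2: "lattice_basis B2 d2 \<Gamma>2"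
    using assms(2) by (rule full_lattice_imp_basis)
  have B1: "finite B1" and exp1: "\<And>v. (\<Sum>b\<in>B1. (d1 b \<bullet> v) *\<^sub>R b) = v"
    and \<Gamma>1: "\<Gamma>1 = {v. \<forall>b\<in>B1. d1 b \<bullet> v \<in> \<int>}"
    and bi1: "\<And>b b'. b \<in> B1 \<Longrightarrow> b' \<in> B1 \<Longrightarrow> d1 b \<bullet> b' = (if b = b' then 1 else 0)"
    using 1 unfolding lattice_basis_def by blast+
  have B2: "finite B2" and exp2: "\<And>v. (\<Sum>b\<in>B2. (d2 b \<bullet> v) *\<^sub>R b) = v"
    and \<Gamma>2: "\<Gamma>2 = {v. \<forall>b\<in>B2. d2 b \<bullet> v \<in> \<int>}"
    and bi2: "\<And>b b'. b \<in> B2 \<Longrightarrow> b' \<in> B2 \<Longrightarrow> d2 b \<bullet> b' = (if b = b' then 1 else 0)"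
    using 2 unfolding lattice_basis_def by blast+
  have nz: "0 \<notin> B1" "0 \<notin> B2"
    using bi1[of 0 0] bi2[of 0 0] by auto
  let ?B1 = "(\<lambda>b. (b, 0)) ` B1 :: ('a \<times> 'b) set" and ?B2 = "Pair 0 ` B2 :: ('a \<times> 'b) set"
  define d :: "'a \<times> 'b \<Rightarrow> 'a \<times> 'b" where
    "d p = (if snd p = 0 then (d1 (fst p), 0) else (0, d2 (snd p)))" for p
  have d_simps: "d (b, 0) = (d1 b, 0)" "c \<in> B2 \<Longrightarrow> d (0, c) = (0, d2 c)" for b c
    using nz by (auto simp: d_def)
  have disj: "?B1 \<inter> ?B2 = {}"
    using nz by auto
  have "(\<Sum>p\<in>?B1 \<union> ?B2. (d p \<bullet> v) *\<^sub>R p) = v" for v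
  proof -
    have "(\<Sum>p\<in>?B1. (d p \<bullet> v) *\<^sub>R p) = (\<Sum>b\<in>B1. ((d1 b \<bullet> fst v) *\<^sub>R b, 0))"
      by (subst sum.reindex) (auto simp: inj_on_def d_simps inner_prod_def intro!: sum.cong)
    moreover have "(\<Sum>p\<in>?B2. (d p \<bullet> v) *\<^sub>R p) = (\<Sum>b\<in>B2. (0, (d2 b \<bullet> snd v) *\<^sub>R b))"
      by (subst sum.reindex) (auto simp: inj_on_def d_simps inner_prod_def intro!: sum.cong)
    ultimately have "(\<Sum>p\<in>?B1 \<union> ?B2. (d p \<bullet> v) *\<^sub>R p) = (fst v, snd v)"
      using B1 B2 disj exp1[of "fst v"] exp2[of "snd v"]
      by (simp add: sum.union_disjoint sum_prod)
    then show ?thesis by simp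
  qed
  moreover have "\<Gamma>1 \<times> \<Gamma>2 = {v. \<forall>p\<in>?B1 \<union> ?B2. d p \<bullet> v \<in> \<int>}"
    by (auto simp: \<Gamma>1 \<Gamma>2 d_simps ball_Un)
  moreover have "d p \<bullet> p' = (if p = p' then 1 else 0)"
    if "p \<in> ?B1 \<union> ?B2" "p' \<in> ?B1 \<union> ?B2" for p p'
    using that nz by (auto simp: d_simps bi1 bi2 split: if_splits)
  ultimately have "lattice_basis (?B1 \<union> ?B2) d (\<Gamma>1 \<times> \<Gamma>2)"
    using B1 B2 unfolding lattice_basis_def by blast
  then show ?thesis
    by (rule lattice_basis_imp_full)
qed

lemma common_denominator:
  assumes "finite S" and "S \<subseteq> \<rat>"
  obtains N :: int where "N > 0" and "\<And>x::real. x \<in> S \<Longrightarrow> of_int N * x \<in> \<int>"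
proof -
  have "\<exists>N::int. N > 0 \<and> (\<forall>x\<in>S. of_int N * x \<in> \<int>)"
    using assms
  proof (induction S rule: finite_induct)
    case empty
    then show ?case by (auto intro: exI[of _ 1])
  next
    case (insert x S)
    then obtain N :: int where N: "N > 0" "\<forall>x\<in>S. of_int N * x \<in> \<int>"
      by auto
    from insert.prems obtain m k :: int where k: "k > 0" "x = of_int m / of_int k"
      by (metis Rats_cases' insert_subset)
    have "of_int (N * k) * x = of_int (N * m)"
      using k by simp
    moreover have "of_int (N * k) * y \<in> \<int>" if "y \<in> S" for y
    proof -
      have "of_int (N * k) * y = of_int k * (of_int N * y)" by simp
      then show ?thesis using N(2) that by (metis Ints_mult Ints_of_int)
    qed
    moreover have "N * k > 0"
      using N(1) k(1) by simp
    ultimately show ?case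
      by (intro exI[of _ "N * k"] conjI ballI) (auto simp del: of_int_mult)
  qed
  then show thesis using that by blast
qed

lemma rational_span_base: "x \<in> \<Gamma> \<Longrightarrow> x \<in> rational_span \<Gamma>"
  unfolding rational_span_def by (auto intro!: exI[of _ 1] exI[of _ x])

lemma rational_span_coords:
  assumes "lattice_basis B d \<Gamma>"
  shows "v \<in> rational_span \<Gamma> \<longleftrightarrow> (\<forall>b\<in>B. d b \<bullet> v \<in> \<rat>)"
proof
  have B: "finite B" and \<Gamma>: "\<Gamma> = {v. \<forall>b\<in>B. d b \<bullet> v \<in> \<int>}"
    using assms unfolding lattice_basis_def by blast+
  show "\<forall>b\<in>B. d b \<bullet> v \<in> \<rat>" if "v \<in> rational_span \<Gamma>"
    using that Ints_subset_Rats by (auto simp: rational_span_def \<Gamma> intro!: Rats_mult)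
  assume rat: "\<forall>b\<in>B. d b \<bullet> v \<in> \<rat>"
  obtain N :: int where N: "N > 0" "\<And>x. x \<in> (\<lambda>b. d b \<bullet> v) ` B \<Longrightarrow> of_int N * x \<in> \<int>"
    using common_denominator[of "(\<lambda>b. d b \<bullet> v) ` B"] B rat by blast
  have "of_int N *\<^sub>R v \<in> \<Gamma>"
    using N(2) by (simp add: \<Gamma>)
  moreover have "v = of_rat (1 / of_int N) *\<^sub>R (of_int N *\<^sub>R v)"
    using N(1) by (simp add: of_rat_divide)
  ultimately show "v \<in> rational_span \<Gamma>"
    unfolding rational_span_def by blast
qed

text \<open>
  The finitely many matrix entries of \<open>h\<close> in a lattice basis have a common denominator.
\<close>

lemma rational_endomorphism_multiple:
  fixes h :: "'a::euclidean_space \<Rightarrow>\<^sub>L 'a"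
  assumes "full_lattice \<Gamma>" and "\<And>x. x \<in> \<Gamma> \<Longrightarrow> h x \<in> rational_span \<Gamma>"
  obtains N :: int where "N > 0" and "\<And>x. x \<in> \<Gamma> \<Longrightarrow> (of_int N *\<^sub>R h) x \<in> \<Gamma>"
proof -
  obtain B d where Bd: "lattice_basis B d \<Gamma>"
    using assms(1) by (rule full_lattice_imp_basis)
  have B: "finite B" and exp: "\<And>v. (\<Sum>b\<in>B. (d b \<bullet> v) *\<^sub>R b) = v"
    and \<Gamma>: "\<Gamma> = {v. \<forall>b\<in>B. d b \<bullet> v \<in> \<int>}"
    using Bd unfolding lattice_basis_def by blast+
  let ?S = "(\<lambda>(b, b'). d b \<bullet> h b') ` (B \<times> B)"
  have "?S \<subseteq> \<rat>"
    using assms(2) lattice_basis_mem[OF Bd] rational_span_coords[OF Bd] by auto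
  then obtain N :: int where N: "N > 0" "\<And>x. x \<in> ?S \<Longrightarrow> of_int N * x \<in> \<int>"
    using common_denominator[of ?S] B by blast
  have "(of_int N *\<^sub>R h) x \<in> \<Gamma>" if x: "x \<in> \<Gamma>" for x
  proof -
    have "d b \<bullet> (of_int N *\<^sub>R h) x \<in> \<int>" if "b \<in> B" for b
    proof -
      have "h x = h (\<Sum>b\<in>B. (d b \<bullet> x) *\<^sub>R b)"
        using exp[of x] by simp
      then have "d b \<bullet> (of_int N *\<^sub>R h) x = (\<Sum>b'\<in>B. (d b' \<bullet> x) * (of_int N * (d b \<bullet> h b')))"
        by (simp add: blinfun.bilinear_simps blinfun.sum_right inner_sum_right sum_distrib_left
            algebra_simps)
      also have "\<dots> \<in> \<int>"
      proof (rule Ints_sum, rule Ints_mult)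
        fix b' assume "b' \<in> B"
        then show "d b' \<bullet> x \<in> \<int>" and "of_int N * (d b \<bullet> h b') \<in> \<int>"
          using x that by (auto simp: \<Gamma> intro!: N(2))
      qed
      finally show ?thesis .
    qed
    then show ?thesis
      by (simp add: \<Gamma>)
  qed
  with N(1) show thesis by (rule that)
qed

lemma rational_form_multiple:
  fixes c :: "'a::euclidean_space \<Rightarrow>\<^sub>L 'a \<Rightarrow>\<^sub>L real"
  assumes "full_lattice \<Gamma>" and "\<And>x y. x \<in> \<Gamma> \<Longrightarrow> y \<in> \<Gamma> \<Longrightarrow> c x y \<in> \<rat>"
  obtains N :: int where "N > 0" and "\<And>x y. x \<in> \<Gamma> \<Longrightarrow> y \<in> \<Gamma> \<Longrightarrow> of_int N * c x y \<in> \<int>"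
proof -
  obtain B d where Bd: "lattice_basis B d \<Gamma>"
    using assms(1) by (rule full_lattice_imp_basis)
  have B: "finite B" and exp: "\<And>v. (\<Sum>b\<in>B. (d b \<bullet> v) *\<^sub>R b) = v"
    and \<Gamma>: "\<Gamma> = {v. \<forall>b\<in>B. d b \<bullet> v \<in> \<int>}"
    using Bd unfolding lattice_basis_def by blast+
  let ?S = "(\<lambda>(b, b'). c b b') ` (B \<times> B)"
  have "?S \<subseteq> \<rat>"
    using assms(2) lattice_basis_mem[OF Bd] by auto
  then obtain N :: int where N: "N > 0" "\<And>x. x \<in> ?S \<Longrightarrow> of_int N * x \<in> \<int>"
    using common_denominator[of ?S] B by blast
  have "of_int N * c x y \<in> \<int>" if x: "x \<in> \<Gamma>" and y: "y \<in> \<Gamma>" for x y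
  proof -
    have "c x y = c (\<Sum>b\<in>B. (d b \<bullet> x) *\<^sub>R b) (\<Sum>b\<in>B. (d b \<bullet> y) *\<^sub>R b)"
      using exp[of x] exp[of y] by simp
    then have "of_int N * c x y =
        (\<Sum>b'\<in>B. \<Sum>b\<in>B. (d b' \<bullet> y) * ((d b \<bullet> x) * (of_int N * c b b')))"
      by (simp add: blinfun.bilinear_simps blinfun.sum_right blinfun.sum_left sum_distrib_left
          algebra_simps)
    also have "\<dots> \<in> \<int>"
    proof (rule Ints_sum, rule Ints_sum)
      fix b' b assume b: "b' \<in> B" "b \<in> B"
      have "d b' \<bullet> y \<in> \<int>" "d b \<bullet> x \<in> \<int>" "of_int N * c b b' \<in> \<int>"
        using b x y by (auto simp: \<Gamma> intro!: N(2))
      then show "(d b' \<bullet> y) * ((d b \<bullet> x) * (of_int N * c b b')) \<in> \<int>"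
        by (rule Ints_mult[OF _ Ints_mult])
    qed
    finally show ?thesis .
  qed
  with N(1) show thesis by (rule that)
qed

text \<open>
  Extend \<open>1 \<mapsto> 1\<close> from the line of rationals to the whole rational vector space of reals.
\<close>

lemma rational_retraction:
  obtains \<pi> :: "real \<Rightarrow> rat" where "\<And>x y. \<pi> (x + y) = \<pi> x + \<pi> y"
    and "\<And>r x. \<pi> (of_rat r * x) = r * \<pi> x" and "\<And>r. \<pi> (of_rat r) = r"
proof -
  interpret RQ: vector_space_pair "\<lambda>r (x::real). of_rat r * x" "\<lambda>r (x::rat). r * x"
    by unfold_locales (auto simp: of_rat_add of_rat_mult algebra_simps)
  have "RQ.vs1.independent {1}"
    by simp
  then obtain \<pi> where \<pi>: "Vector_Spaces.linear (\<lambda>r (x::real). of_rat r * x) (\<lambda>r (x::rat). r * x) \<pi>" "\<pi> 1 = 1"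
    using RQ.linear_independent_extend[of "{1}" "\<lambda>_. 1"] by auto
  interpret \<pi>: Vector_Spaces.linear "\<lambda>r (x::real). of_rat r * x" "\<lambda>r (x::rat). r * x" \<pi>
    by fact
  show thesis
    using \<pi>.add \<pi>.scale \<pi>.scale[of _ 1] \<pi>(2) by (intro that[of \<pi>]) auto
qed

text \<open>
  This is the fact that the inverse of a rational matrix is rational.  A \<open>\<rat>\<close>-linear retraction \<open>\<pi>\<close> of
  \<open>\<real>\<close> onto \<open>\<rat>\<close>, applied to the real coordinates of \<open>u\<close>, yields a rational vector \<open>u'\<close>; as the numbers
  \<open>s u y\<close> and the matrix of \<open>s\<close> are rational, \<open>u'\<close> satisfies the same linear equations as \<open>u\<close>, and these
  have only one solution.
\<close>

lemma rational_by_nondegenerate_pairing: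
  fixes s :: "'a::euclidean_space \<Rightarrow>\<^sub>L 'a \<Rightarrow>\<^sub>L real"
  assumes \<Gamma>: "full_lattice \<Gamma>" and rat: "\<And>x y. x \<in> \<Gamma> \<Longrightarrow> y \<in> \<Gamma> \<Longrightarrow> s x y \<in> \<rat>"
    and nondeg: "nondegenerate_form s" and u: "\<And>y. y \<in> \<Gamma> \<Longrightarrow> s u y \<in> \<rat>"
  shows "u \<in> rational_span \<Gamma>"
proof -
  obtain B d where Bd: "lattice_basis B d \<Gamma>"
    using \<Gamma> by (rule full_lattice_imp_basis)
  have B: "finite B" and exp: "\<And>v. (\<Sum>b\<in>B. (d b \<bullet> v) *\<^sub>R b) = v"
    using Bd unfolding lattice_basis_def by blast+
  obtain \<pi> :: "real \<Rightarrow> rat" where \<pi>: "\<And>x y. \<pi> (x + y) = \<pi> x + \<pi> y"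
    "\<And>r x. \<pi> (of_rat r * x) = r * \<pi> x" "\<And>r. \<pi> (of_rat r) = r"
    using rational_retraction by blast
  have \<pi>0: "\<pi> 0 = 0"
    using \<pi>(3)[of 0] by simp
  have \<pi>_sum: "\<pi> (\<Sum>b\<in>A. f b) = (\<Sum>b\<in>A. \<pi> (f b))" if "finite A" for A f
    using that by (induction A rule: finite_induct) (simp_all add: \<pi>0 \<pi>(1))
  have \<pi>_scale: "of_rat (\<pi> (x * y)) = of_rat (\<pi> x) * y" if "y \<in> \<rat>" for x y
  proof -
    from that obtain r where r: "y = of_rat r"
      by (rule Rats_cases)
    have "\<pi> (x * y) = r * \<pi> x"
      using \<pi>(2)[of r x] by (simp add: r mult.commute)
    then show ?thesis
      by (simp add: r of_rat_mult)
  qed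
  have \<pi>_id: "of_rat (\<pi> y) = y" if "y \<in> \<rat>" for y
    using that \<pi>(3) by (auto elim!: Rats_cases)
  define u' where "u' = (\<Sum>b\<in>B. of_rat (\<pi> (d b \<bullet> u)) *\<^sub>R b)"
  have s_u': "s u' y = s u y" if y: "y \<in> B" for y
  proof -
    have y\<Gamma>: "y \<in> \<Gamma>"
      using y lattice_basis_mem[OF Bd] by blast
    have "s u y = s (\<Sum>b\<in>B. (d b \<bullet> u) *\<^sub>R b) y"
      using exp[of u] by simp
    also have "\<dots> = (\<Sum>b\<in>B. (d b \<bullet> u) * s b y)"
      by (simp add: blinfun.bilinear_simps blinfun.sum_right blinfun.sum_left)
    finally have su: "s u y = (\<Sum>b\<in>B. (d b \<bullet> u) * s b y)" .
    have "s u y = of_rat (\<pi> (s u y))"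
      using \<pi>_id u[OF y\<Gamma>] by simp
    also have "\<dots> = (\<Sum>b\<in>B. of_rat (\<pi> ((d b \<bullet> u) * s b y)))"
      unfolding su using B by (simp add: \<pi>_sum of_rat_sum)
    also have "\<dots> = (\<Sum>b\<in>B. of_rat (\<pi> (d b \<bullet> u)) * s b y)"
      using rat y\<Gamma> lattice_basis_mem[OF Bd] by (intro sum.cong refl \<pi>_scale) auto
    also have "\<dots> = s u' y"
      by (simp add: u'_def blinfun.bilinear_simps blinfun.sum_right blinfun.sum_left)
    finally show ?thesis by simp
  qed
  have "s (u' - u) w = 0" for w
  proof -
    have "s (u' - u) w = s (u' - u) (\<Sum>b\<in>B. (d b \<bullet> w) *\<^sub>R b)"
      using exp[of w] by simp
    also have "\<dots> = (\<Sum>b\<in>B. (d b \<bullet> w) * s (u' - u) b)"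
      by (simp add: blinfun.scaleR_right blinfun.sum_right)
    also have "\<dots> = 0"
      by (intro sum.neutral) (simp add: blinfun.bilinear_simps s_u')
    finally show ?thesis .
  qed
  then have "u' - u = 0"
    using nondeg unfolding nondegenerate_form_def by blast
  moreover have "u' \<in> rational_span \<Gamma>"
    by (simp add: rational_span_coords[OF Bd] u'_def lattice_basis_coord_sum[OF Bd])
  ultimately show ?thesis
    by simp
qed

text \<open>
  The preimages \<open>p b\<close> of a basis of \<open>\<Gamma>2\<close> define a real-linear right inverse \<open>f\<close> of \<open>e\<close>.  On rational
  vectors \<open>f\<close> is also a left inverse, by injectivity there, and the rational vectors span the real space.
\<close>

lemma invertible_of_rational_bijection:
  fixes e :: "'m::euclidean_space \<Rightarrow>\<^sub>L 'n::euclidean_space"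
  assumes \<Gamma>1: "full_lattice \<Gamma>1" and \<Gamma>2: "full_lattice \<Gamma>2"
    and bij: "bij_betw (blinfun_apply e) (rational_span \<Gamma>1) (rational_span \<Gamma>2)"
  shows "invertible_blinfun e"
proof -
  obtain B1 d1 where 1: "lattice_basis B1 d1 \<Gamma>1"
    using \<Gamma>1 by (rule full_lattice_imp_basis)
  obtain B2 d2 where 2: "lattice_basis B2 d2 \<Gamma>2"
    using \<Gamma>2 by (rule full_lattice_imp_basis)
  have exp1: "\<And>v. (\<Sum>b\<in>B1. (d1 b \<bullet> v) *\<^sub>R b) = v"
    and exp2: "\<And>v. (\<Sum>b\<in>B2. (d2 b \<bullet> v) *\<^sub>R b) = v"
    using 1 2 unfolding lattice_basis_def by blast+
  define p where "p = inv_into (rational_span \<Gamma>1) (blinfun_apply e)"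
  have p: "p b \<in> rational_span \<Gamma>1" "e (p b) = b" if "b \<in> B2" for b
  proof -
    have "b \<in> blinfun_apply e ` rational_span \<Gamma>1"
      using rational_span_base[OF lattice_basis_mem[OF 2 that]] by (simp only: bij_betw_imp_surj_on[OF bij])
    then show "p b \<in> rational_span \<Gamma>1" "e (p b) = b"
      unfolding p_def by (rule inv_into_into, rule f_inv_into_f)
  qed
  define f where "f = Blinfun (\<lambda>y. \<Sum>b\<in>B2. (d2 b \<bullet> y) *\<^sub>R p b)"
  have f: "f y = (\<Sum>b\<in>B2. (d2 b \<bullet> y) *\<^sub>R p b)" for y
    unfolding f_def
    by (subst bounded_linear_Blinfun_apply)
       (auto intro!: bounded_linear_sum bounded_linear_scaleR_const bounded_linear_inner_right)
  have ef: "e (f y) = y" for y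
    by (simp add: f blinfun.sum_right blinfun.scaleR_right p(2) exp2)
  have fe_rational: "f (e x) = x" if x: "x \<in> rational_span \<Gamma>1" for x
  proof -
    have "e x \<in> rational_span \<Gamma>2"
      using x by (rule bij_betw_apply[OF bij])
    then have "\<forall>b\<in>B2. d2 b \<bullet> e x \<in> \<rat>"
      by (simp add: rational_span_coords[OF 2])
    then have "f (e x) \<in> rational_span \<Gamma>1"
      using p(1) by (auto simp: rational_span_coords[OF 1] f inner_sum_right intro!: Rats_mult Rats_sum)
    then show ?thesis
      using x by (rule inj_onD[OF bij_betw_imp_inj_on[OF bij] ef])
  qed
  have "f (e x) = x" for x
  proof -
    have "f (e x) = f (e (\<Sum>b\<in>B1. (d1 b \<bullet> x) *\<^sub>R b))"
      by (simp only: exp1)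
    also have "\<dots> = (\<Sum>b\<in>B1. (d1 b \<bullet> x) *\<^sub>R b)"
      using fe_rational[OF rational_span_base[OF lattice_basis_mem[OF 1]]]
      by (simp add: blinfun.sum_right blinfun.scaleR_right)
    finally show ?thesis
      by (simp only: exp1)
  qed
  with ef show ?thesis
    by (rule invertible_blinfunI[rotated])
qed

lemma dual_lattice_Times:
  assumes "0 \<in> \<Gamma>1" and "0 \<in> \<Gamma>2"
  shows "dual_lattice (\<Gamma>1 \<times> \<Gamma>2) = dual_lattice \<Gamma>1 \<times> dual_lattice \<Gamma>2"
proof (intro equalityI subsetI)
  fix p assume p: "p \<in> dual_lattice (\<Gamma>1 \<times> \<Gamma>2)"
  have "p \<bullet> (x, 0) \<in> \<int>" "p \<bullet> (0, y) \<in> \<int>" if "x \<in> \<Gamma>1" "y \<in> \<Gamma>2" for x y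
    using p that assms by (auto simp: dual_lattice_def)
  then show "p \<in> dual_lattice \<Gamma>1 \<times> dual_lattice \<Gamma>2"
    using assms by (cases p) (auto simp: dual_lattice_def)
qed (auto simp: dual_lattice_def)

lemma zero_in_full_lattice: "full_lattice \<Gamma> \<Longrightarrow> 0 \<in> \<Gamma>"
  unfolding full_lattice_def by (auto intro!: exI[of _ "\<lambda>_. 0"])

section \<open>Swapping the second summand with its dual\<close>

text \<open>
  If \<open>\<xi>\<close> is represented by the pair \<open>(u1, u2)\<close>, this is the map \<open>((x1, x2), (u1, u2)) \<mapsto> ((x1, u2), (u1, x2))\<close>,
  the exchange of \<open>N\<close> with its dual.
\<close>

definition half_swap :: "(('m::euclidean_space \<times> 'n::euclidean_space) \<times> (('m \<times> 'n) \<Rightarrow>\<^sub>L real)) \<Rightarrow>\<^sub>L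
    (('m \<times> 'n) \<times> (('m \<times> 'n) \<Rightarrow>\<^sub>L real))" where
  "half_swap = Blinfun (\<lambda>p. ((fst (fst p), snd (riesz_inv (snd p))),
                             riesz (fst (riesz_inv (snd p)), snd (fst p))))"

lemma half_swap_apply:
  "half_swap (v, \<xi>) = ((fst v, snd (riesz_inv \<xi>)), riesz (fst (riesz_inv \<xi>), snd v))"
  unfolding half_swap_def
  by (subst bounded_linear_Blinfun_apply)
     (auto intro!: bounded_linear_intros blinfun.bounded_linear_right
        bounded_linear_compose[OF blinfun.bounded_linear_right])

lemma half_swap_involution: "half_swap (half_swap p) = p"
  by (cases p) (simp add: half_swap_apply)

lemma Q_form_half_swap:
  "Q_form (half_swap p) (half_swap p') = Q_form p p'"
proof -
  have *: "blinfun_apply \<xi> v = fst (riesz_inv \<xi>) \<bullet> fst v + snd (riesz_inv \<xi>) \<bullet> snd v" for \<xi> :: "('a \<times> 'b) \<Rightarrow>\<^sub>L real" and v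
    by (metis inner_prod_def riesz_inv_inner)
  show ?thesis
    by (cases p; cases p') (simp add: half_swap_apply Q_form_def * inner_commute)
qed

text \<open>
  Off-diagonal forms map \<open>M\<close> to \<open>N\<^sup>*\<close> and \<open>N\<close> to \<open>M\<^sup>*\<close>, so that \<open>I\<^sub>\<omega>\<close> acts separately on \<open>M \<oplus> N\<^sup>*\<close> and
  on \<open>M\<^sup>* \<oplus> N\<close>.  On \<open>M \<oplus> N\<^sup>*\<close> it acts by the formula for \<open>J(t)\<close> transported by \<open>G\<close>, and on the other
  summand it acts by the dual structure because the forms are skew.
\<close>

lemma half_swap_intertwines:
  fixes G :: "'m::euclidean_space \<Rightarrow>\<^sub>L 'n::euclidean_space" and t1 t2 :: "'m \<Rightarrow>\<^sub>L 'm"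
    and L1 :: "'m set" and L2 :: "'n set"
  assumes G: "invertible_blinfun G" and t2: "invertible_blinfun t2"
  defines "B \<equiv> G_torus L1 L2 G t1 t2"
  shows "half_swap o\<^sub>L I_cstr (skew_form (G o\<^sub>L t1), skew_form (G o\<^sub>L t2)) =
         cstr (prod_torus B (dual_torus B)) o\<^sub>L half_swap"
proof (rule blinfun_eqI)
  fix p :: "('m \<times> 'n) \<times> (('m \<times> 'n) \<Rightarrow>\<^sub>L real)"
  obtain x1 x2 u1 p2 where p: "p = ((x1, x2), riesz (u1, G p2))"
    by (metis inv_blinfun_right[OF G] prod.exhaust riesz_riesz_inv)
  define \<phi>1 where "\<phi>1 = skew_form (G o\<^sub>L t1)"
  define \<phi>2 where "\<phi>2 = skew_form (G o\<^sub>L t2)"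
  have inv: "invertible_blinfun \<phi>2"
    unfolding \<phi>2_def
    by (intro invertible_nondegenerate_form skew_form_nondegenerate invertible_blinfun_compose G t2)
  \<comment> \<open>The components of \<open>I\<^sub>\<omega> p\<close> are \<open>z\<close> and \<open>\<phi>2 x + \<phi>1 z\<close>; the defining equation of \<open>z\<close> splits into one equation for \<open>z1\<close> and one for \<open>z2\<close>.\<close>
  obtain z1 z2 where z: "inv_blinfun \<phi>2 (\<phi>1 (x1, x2) - riesz (u1, G p2)) = (z1, z2)"
    by fastforce
  have "\<phi>2 (z1, z2) = \<phi>1 (x1, x2) - riesz (u1, G p2)"
    by (simp add: z[symmetric] inv)
  then have "\<phi>2 (z1, z2) (a, b) = \<phi>1 (x1, x2) (a, b) - (u1, G p2) \<bullet> (a, b)" for a b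
    by (simp add: blinfun.bilinear_simps)
  then have eq: "G (t2 z1) \<bullet> b - G (t2 a) \<bullet> z2 =
      G (t1 x1) \<bullet> b - G (t1 a) \<bullet> x2 - u1 \<bullet> a - G p2 \<bullet> b" for a b
    by (simp add: \<phi>1_def \<phi>2_def algebra_simps)
  have "G (t2 z1) \<bullet> b = G (t1 x1 - p2) \<bullet> b" for b
    using eq[of b 0] by (simp add: blinfun.bilinear_simps inner_diff_left)
  then have "G (t2 z1) = G (t1 x1 - p2)"
    by (rule inner_eqI)
  then have t2z1: "t2 z1 = t1 x1 - p2"
    by (rule invertible_blinfun_inj[OF G])
  then have z1: "inv_blinfun t2 (t1 x1 - p2) = z1"
    by (metis inv_blinfun_left t2)
  have z2: "u1 \<bullet> a + G (t1 a) \<bullet> x2 = G (t2 a) \<bullet> z2" for a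
    using eq[of 0 a] by simp
  obtain r1 r2 where r: "riesz_inv (\<phi>2 (x1, x2) + \<phi>1 (z1, z2)) = (r1, r2)"
    by fastforce
  have r_eq: "r1 \<bullet> a + r2 \<bullet> b = \<phi>2 (x1, x2) (a, b) + \<phi>1 (z1, z2) (a, b)" for a b
    using riesz_inv_inner[of "\<phi>2 (x1, x2) + \<phi>1 (z1, z2)" "(a, b)"]
    by (simp only: r blinfun.add_left inner_Pair)
  have r1: "r1 \<bullet> a = - (G (t2 a) \<bullet> x2) - G (t1 a) \<bullet> z2" for a
    using r_eq[of a 0] by (simp add: \<phi>1_def \<phi>2_def)
  have "r2 \<bullet> b = G (t2 x1 + t1 z1) \<bullet> b" for b
    using r_eq[of 0 b] by (simp add: \<phi>1_def \<phi>2_def blinfun.bilinear_simps inner_add_left)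
  then have r2: "r2 = G (t2 x1 + t1 z1)"
    by (rule inner_eqI)
  \<comment> \<open>On \<open>M\<^sup>* \<oplus> N\<close>: this says that \<open>(r1, z2)\<close> is the image of \<open>(u1, x2)\<close> under the dual structure.\<close>
  have dual: "(r1, z2) \<bullet> w = - ((u1, x2) \<bullet> cstr B w)" for w
  proof -
    obtain a b where w: "w = (a, G b)"
      by (metis inv_blinfun_right[OF G] prod.exhaust)
    define a' where "a' = inv_blinfun t2 (t1 a - b)"
    have a': "t2 a' = t1 a - b"
      by (simp add: a'_def t2)
    have "cstr B w = (a', G (t2 a + t1 a'))"
      by (simp add: B_def w cstr_G_torus_apply G Let_def a'_def)
    moreover have "u1 \<bullet> a' + G (t1 a') \<bullet> x2 = G (t1 a) \<bullet> z2 - G b \<bullet> z2"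
      using z2[of a'] by (simp add: a' blinfun.bilinear_simps inner_diff_left)
    ultimately show ?thesis
      using r1[of a] by (simp add: w blinfun.bilinear_simps inner_add_right inner_commute)
  qed
  \<comment> \<open>On \<open>M \<oplus> N\<^sup>*\<close>.\<close>
  have J: "cstr B (x1, G p2) = (z1, r2)"
    by (simp add: B_def cstr_G_torus_apply G Let_def z1 r2)
  have "I_cstr (\<phi>1, \<phi>2) p = ((z1, z2), \<phi>2 (x1, x2) + \<phi>1 (z1, z2))"
    by (simp add: p I_cstr_def matrix_cstr_apply Let_def z)
  then have "half_swap (I_cstr (\<phi>1, \<phi>2) p) = ((z1, r2), riesz (r1, z2))"
    by (simp add: half_swap_apply r)
  also have "riesz (r1, z2) = transpose_blinfun (- cstr B) (riesz (u1, x2))"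
    using dual by (intro blinfun_eqI) (simp add: blinfun.bilinear_simps)
  also have "((z1, r2), \<dots>) = cstr (prod_torus B (dual_torus B)) (half_swap p)"
    by (simp add: p half_swap_apply prod_torus_def dual_torus_def J)
  finally show "(half_swap o\<^sub>L I_cstr (skew_form (G o\<^sub>L t1), skew_form (G o\<^sub>L t2))) p =
      (cstr (prod_torus B (dual_torus B)) o\<^sub>L half_swap) p"
    by (simp add: \<phi>1_def \<phi>2_def)
qed

lemma mem_Lambda_iff:
  "(v, \<xi>) \<in> Lambda A \<longleftrightarrow> v \<in> lat A \<and> riesz_inv \<xi> \<in> dual_lattice (lat A)"
  by (simp add: Lambda_def prod_torus_def dual_torus_def dual_lattice_def)

text \<open>
  Both lattices are products of \<open>\<Gamma>1\<close>, \<open>\<Gamma>2\<close> and their duals, since \<open>\<Gamma>2\<close> is its own double dual; only the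
  order of the factors differs.
\<close>

lemma half_swap_bij_Lambda:
  assumes \<Gamma>: "full_lattice \<Gamma>1" "full_lattice \<Gamma>2"
    and A: "lat A = \<Gamma>1 \<times> \<Gamma>2" and B: "lat B = \<Gamma>1 \<times> dual_lattice \<Gamma>2"
  shows "bij_betw half_swap (Lambda A) (Lambda B)"
proof -
  note zero = zero_in_full_lattice[OF \<Gamma>(1)] zero_in_full_lattice[OF \<Gamma>(2)]
    zero_in_full_lattice[OF full_lattice_dual[OF \<Gamma>(2)]]
  have mem_A: "(v, \<xi>) \<in> Lambda A \<longleftrightarrow> v \<in> \<Gamma>1 \<times> \<Gamma>2 \<and> riesz_inv \<xi> \<in> dual_lattice \<Gamma>1 \<times> dual_lattice \<Gamma>2"
    and mem_B: "(v, \<xi>) \<in> Lambda B \<longleftrightarrow> v \<in> \<Gamma>1 \<times> dual_lattice \<Gamma>2 \<and> riesz_inv \<xi> \<in> dual_lattice \<Gamma>1 \<times> \<Gamma>2"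
    for v \<xi>
    by (simp_all add: mem_Lambda_iff A B dual_lattice_Times zero double_dual_lattice \<Gamma>)
  have "half_swap ` Lambda A \<subseteq> Lambda B"
    by (auto simp: half_swap_apply mem_A mem_B mem_Times_iff)
  moreover have "half_swap ` Lambda B \<subseteq> Lambda A"
    by (auto simp: half_swap_apply mem_A mem_B mem_Times_iff)
  ultimately show ?thesis
    by (intro bij_betw_byWitness[where f' = half_swap]) (auto simp: half_swap_involution)
qed

text \<open>
  The pairs \<open>(e, q)\<close> and \<open>(G, t)\<close> play symmetric roles: one intertwining relation is the instance of
  \<open>half_swap_intertwines\<close> for \<open>(G, t)\<close>, the other is the instance for \<open>(e, q)\<close> conjugated by the
  involution.
\<close>

lemma mirror_symmetric_G_tori:
  fixes G e :: "'m::euclidean_space \<Rightarrow>\<^sub>L 'n::euclidean_space" and q1 q2 t1 t2 :: "'m \<Rightarrow>\<^sub>L 'm"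
    and \<Gamma>1 :: "'m set" and \<Gamma>2 :: "'n set"
  defines "A \<equiv> G_torus \<Gamma>1 \<Gamma>2 e q1 q2" and "B \<equiv> G_torus \<Gamma>1 (dual_lattice \<Gamma>2) G t1 t2"
    and "\<omega> \<equiv> (skew_form (G o\<^sub>L t1), skew_form (G o\<^sub>L t2))"
    and "\<eta> \<equiv> (skew_form (e o\<^sub>L q1), skew_form (e o\<^sub>L q2))"
  assumes \<Gamma>: "full_lattice \<Gamma>1" "full_lattice \<Gamma>2"
    and inv: "invertible_blinfun G" "invertible_blinfun e" "invertible_blinfun q2" "invertible_blinfun t2"
    and \<omega>: "\<omega> \<in> NS_C0 A" and \<eta>: "\<eta> \<in> NS_C0 B"
  shows "mirror_symmetric (A, \<omega>) (B, \<eta>)"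
proof -
  let ?JA = "cstr (prod_torus A (dual_torus A))" and ?JB = "cstr (prod_torus B (dual_torus B))"
  have A: "complex_torus A"
    unfolding complex_torus_def A_def
    using full_lattice_Times[OF \<Gamma>] cstr_G_torus_squared[OF inv(2,3)] by simp
  have B: "complex_torus B"
    unfolding complex_torus_def B_def
    using full_lattice_Times[OF \<Gamma>(1) full_lattice_dual[OF \<Gamma>(2)]] cstr_G_torus_squared[OF inv(1,4)]
    by simp
  have \<omega>_B: "half_swap o\<^sub>L I_cstr \<omega> = ?JB o\<^sub>L half_swap"
    unfolding B_def \<omega>_def by (rule half_swap_intertwines[OF inv(1,4)])
  have \<eta>_A: "half_swap o\<^sub>L I_cstr \<eta> = ?JA o\<^sub>L half_swap"
    unfolding A_def \<eta>_def by (rule half_swap_intertwines[OF inv(2,3)])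
  have "half_swap o\<^sub>L ?JA = I_cstr \<eta> o\<^sub>L half_swap"
  proof (rule blinfun_eqI)
    fix p
    have "?JA p = half_swap (I_cstr \<eta> (half_swap p))"
      using arg_cong[OF \<eta>_A, of "\<lambda>f. blinfun_apply f (half_swap p)"]
      by (simp add: half_swap_involution)
    then show "(half_swap o\<^sub>L ?JA) p = (I_cstr \<eta> o\<^sub>L half_swap) p"
      by (simp add: half_swap_involution)
  qed
  moreover have "bij_betw half_swap (Lambda A) (Lambda B)"
    by (rule half_swap_bij_Lambda[OF \<Gamma>]) (simp_all add: A_def B_def)
  ultimately show ?thesis
    unfolding mirror_symmetric_def weak_pair_def Let_def fst_conv snd_conv
    using A B \<omega> \<eta> \<omega>_B by (intro conjI exI[of _ half_swap] ballI Q_form_half_swap)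
qed

section \<open>Neron-Severi groups\<close>

text \<open>
  Some positive integer multiple of the form is integral on the lattice, hence a class in \<open>NS\<close>.
\<close>

lemma skew_form_in_span_NS:
  fixes u :: "'m::euclidean_space \<Rightarrow>\<^sub>L 'n::euclidean_space"
  assumes \<Gamma>: "full_lattice (\<Gamma>1 \<times> \<Gamma>2)" and lat: "lat A = \<Gamma>1 \<times> \<Gamma>2"
    and rat: "\<And>x y. x \<in> \<Gamma>1 \<Longrightarrow> y \<in> \<Gamma>2 \<Longrightarrow> u x \<bullet> y \<in> \<rat>"
    and inv: "\<And>v w. skew_form u (cstr A v) (cstr A w) = skew_form u v w"
  shows "skew_form u \<in> span (NS A)"
proof -
  have "skew_form u v w \<in> \<rat>" if "v \<in> \<Gamma>1 \<times> \<Gamma>2" "w \<in> \<Gamma>1 \<times> \<Gamma>2" for v w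
    using that rat by auto
  then obtain N :: int where N: "N > 0"
    "\<And>v w. v \<in> \<Gamma>1 \<times> \<Gamma>2 \<Longrightarrow> w \<in> \<Gamma>1 \<times> \<Gamma>2 \<Longrightarrow> of_int N * skew_form u v w \<in> \<int>"
    using rational_form_multiple[OF \<Gamma>, of "skew_form u"] by blast
  have "of_int N *\<^sub>R skew_form u \<in> NS A"
    unfolding NS_def mem_Collect_eq
  proof (intro conjI allI ballI)
    fix v w
    show "(of_int N *\<^sub>R skew_form u) v w = - (of_int N *\<^sub>R skew_form u) w v"
      by (simp add: blinfun.bilinear_simps algebra_simps)
    show "(of_int N *\<^sub>R skew_form u) (cstr A v) (cstr A w) = (of_int N *\<^sub>R skew_form u) v w"
      by (simp only: blinfun.scaleR_left inv)
  next
    fix v w assume "v \<in> lat A" "w \<in> lat A"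
    then show "(of_int N *\<^sub>R skew_form u) v w \<in> \<int>"
      using N(2)[of v w] by (simp only: blinfun.scaleR_left real_scaleR_def lat)
  qed
  then have "(1 / of_int N) *\<^sub>R (of_int N *\<^sub>R skew_form u) \<in> span (NS A)"
    by (intro span_scale span_base)
  then show ?thesis
    using N(1) by simp
qed

text \<open>
  The endomorphism is a multiple of \<open>k = s\<^sup>-\<^sup>1 c\<close>.  It is rational because \<open>s\<close> and \<open>c\<close> are, and it commutes
  with the complex structure because that structure preserves both \<open>s\<close> and \<open>c\<close>.
\<close>

lemma NS_via_endomorphism:
  fixes c s :: "'v::euclidean_space \<Rightarrow>\<^sub>L 'v \<Rightarrow>\<^sub>L real"
  assumes A: "complex_torus A" and s: "nondegenerate_form s"
    and rat: "\<And>x y. x \<in> lat A \<Longrightarrow> y \<in> lat A \<Longrightarrow> s x y \<in> \<rat>"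
    and inv: "\<And>v w. s (cstr A v) (cstr A w) = s v w"
    and c: "c \<in> NS A"
  obtains N :: int and h where "N > 0" and "h \<in> End_torus A"
    and "\<And>v w. of_int N * c v w = s (h v) w"
proof -
  have lat: "full_lattice (lat A)" and J: "cstr A o\<^sub>L cstr A = - id_blinfun"
    using A by (auto simp: complex_torus_def)
  have J2: "cstr A (cstr A v) = - v" for v
    using J by (metis blinfun.minus_left blinfun_apply_blinfun_compose blinfun_apply_id_blinfun)
  note inv_s = invertible_nondegenerate_form[OF s]
  define k where "k = inv_blinfun s o\<^sub>L c"
  have k: "s (k v) = c v" for v
    by (simp add: k_def inv_s)
  have "k x \<in> rational_span (lat A)" if "x \<in> lat A" for x
  proof (rule rational_by_nondegenerate_pairing[OF lat rat s])
    fix y assume "y \<in> lat A"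
    then have "c x y \<in> \<int>"
      using c that unfolding NS_def by blast
    then show "s (k x) y \<in> \<rat>"
      using Ints_subset_Rats by (auto simp: k)
  qed
  then obtain N :: int where N: "N > 0" "\<And>x. x \<in> lat A \<Longrightarrow> (of_int N *\<^sub>R k) x \<in> lat A"
    using rational_endomorphism_multiple[OF lat] by blast
  have "k (cstr A v) = cstr A (k v)" for v
  proof -
    have "s (k (cstr A v) - cstr A (k v)) w = 0" for w
    proof -
      \<comment> \<open>Invariance of the forms applies to images under \<open>cstr A\<close> only, so the test vector is written as one.\<close>
      have w: "w = cstr A (cstr A (- w))"
        by (simp add: J2)
      have "s (k (cstr A v)) (cstr A (cstr A (- w))) = c (cstr A v) (cstr A (cstr A (- w)))"
        by (simp only: k)
      also have "\<dots> = c v (cstr A (- w))"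
        using c unfolding NS_def by blast
      also have "\<dots> = s (k v) (cstr A (- w))"
        by (simp only: k)
      also have "\<dots> = s (cstr A (k v)) (cstr A (cstr A (- w)))"
        by (simp only: inv)
      finally show ?thesis
        by (simp only: w[symmetric] blinfun.diff_right blinfun.diff_left right_minus_eq)
    qed
    then have "k (cstr A v) - cstr A (k v) = 0"
      using s unfolding nondegenerate_form_def by blast
    then show ?thesis by simp
  qed
  then have "of_int N *\<^sub>R k \<in> End_torus A"
    using N(2) unfolding End_torus_def
    by (auto intro!: blinfun_eqI simp: blinfun.bilinear_simps)
  with N(1) show thesis
    by (rule that) (simp add: blinfun.bilinear_simps k)
qed

text \<open>
  The reference form \<open>skew_form G\<close> is a rational multiple of a class in the Neron-Severi group, being the
  case \<open>q = id\<close> of \<open>skew_form_invariant\<close> with \<open>e\<close> and \<open>G\<close> exchanged.  Comparing \<open>c\<close> with it gives an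
  endomorphism of the torus, hence an element \<open>a\<close> acting diagonally; evaluating the skew symmetry of \<open>c\<close> on
  one vector from each summand shows that \<open>a\<close> acts self-adjointly.
\<close>

lemma NS_G_torus:
  fixes G e :: "'m::euclidean_space \<Rightarrow>\<^sub>L 'n::euclidean_space" and q1 q2 :: "'m \<Rightarrow>\<^sub>L 'm"
    and \<Gamma>1 :: "'m set" and \<Gamma>2 :: "'n set"
  defines "A \<equiv> G_torus \<Gamma>1 \<Gamma>2 e q1 q2"
  assumes \<Gamma>: "full_lattice \<Gamma>1" "full_lattice \<Gamma>2"
    and inv: "invertible_blinfun G" "invertible_blinfun e" "invertible_blinfun q2"
    and sym: "\<And>x y. G x \<bullet> e y = G y \<bullet> e x"
    and rat: "\<And>x y. x \<in> \<Gamma>1 \<Longrightarrow> y \<in> \<Gamma>2 \<Longrightarrow> G x \<bullet> y \<in> \<rat>"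
    and q1: "\<And>x y. G (q1 x) \<bullet> e y = G x \<bullet> e (q1 y)"
    and q2: "\<And>x y. G (q2 x) \<bullet> e y = G x \<bullet> e (q2 y)"
    and End: "End_torus A \<subseteq> range (diag_action \<rho>1 \<rho>2)"
    and equivariant: "\<And>a. e o\<^sub>L \<rho>1 a = \<rho>2 a o\<^sub>L e"
    and c: "c \<in> NS A"
  obtains r a where "c = skew_form (G o\<^sub>L (r *\<^sub>R \<rho>1 a))"
    and "\<And>x y. G (\<rho>1 a x) \<bullet> e y = G x \<bullet> e (\<rho>1 a y)"
proof -
  have lat: "lat A = \<Gamma>1 \<times> \<Gamma>2"
    by (simp add: A_def)
  have torus: "complex_torus A"
    unfolding complex_torus_def lat
    using full_lattice_Times[OF \<Gamma>] cstr_G_torus_squared[OF inv(2,3)] by (simp add: A_def)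
  have rational: "skew_form G v w \<in> \<rat>" if "v \<in> lat A" "w \<in> lat A" for v w
    using that rat by (auto simp: lat)
  have invariant: "skew_form G (cstr A v) (cstr A w) = skew_form G v w" for v w
  proof -
    have "skew_form (G o\<^sub>L id_blinfun) (cstr A v) (cstr A w) = skew_form (G o\<^sub>L id_blinfun) v w"
      unfolding A_def using sym q1 q2
      by (intro skew_form_invariant inv) (auto intro!: blinfun_eqI simp: inner_commute)
    moreover have "G o\<^sub>L id_blinfun = G"
      by (rule blinfun_eqI) simp
    ultimately show ?thesis
      by simp
  qed
  obtain N :: int and h where N: "N > 0" and h: "h \<in> End_torus A"
    and Nc: "\<And>v w. of_int N * c v w = skew_form G (h v) w"
    using NS_via_endomorphism[OF torus skew_form_nondegenerate[OF inv(1)] rational invariant c]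
    by blast
  obtain a where a: "h = diag_action \<rho>1 \<rho>2 a"
    using h End by blast
  have Nc_apply: "of_int N * c (x1, x2) (y1, y2) = G (\<rho>1 a x1) \<bullet> y2 - G y1 \<bullet> \<rho>2 a x2" for x1 x2 y1 y2
    by (simp add: Nc a diag_action_def)
  have skew: "c v w = - c w v" for v w
    using c unfolding NS_def by blast
  have self_adjoint: "G (\<rho>1 a x) \<bullet> y = G x \<bullet> \<rho>2 a y" for x y
    using Nc_apply[of x 0 0 y] Nc_apply[of 0 y x 0] skew[of "(x, 0)" "(0, y)"] by simp
  have e_\<rho>: "\<rho>2 a (e y) = e (\<rho>1 a y)" for y
    using equivariant[of a] by (metis blinfun_apply_blinfun_compose)
  have "c = skew_form (G o\<^sub>L ((1 / of_int N) *\<^sub>R \<rho>1 a))"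
  proof (intro blinfun_eqI)
    fix v w
    have "of_int N * c v w = G (\<rho>1 a (fst v)) \<bullet> snd w - G (\<rho>1 a (fst w)) \<bullet> snd v"
      using Nc_apply[of "fst v" "snd v" "fst w" "snd w"] by (simp add: self_adjoint)
    moreover have "of_int N * skew_form (G o\<^sub>L ((1 / of_int N) *\<^sub>R \<rho>1 a)) v w =
        G (\<rho>1 a (fst v)) \<bullet> snd w - G (\<rho>1 a (fst w)) \<bullet> snd v"
      using N by (simp add: blinfun.bilinear_simps field_simps)
    ultimately have "of_int N * c v w = of_int N * skew_form (G o\<^sub>L ((1 / of_int N) *\<^sub>R \<rho>1 a)) v w"
      by simp
    then show "c v w = skew_form (G o\<^sub>L ((1 / of_int N) *\<^sub>R \<rho>1 a)) v w"
      using N by simp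
  qed
  moreover have "G (\<rho>1 a x) \<bullet> e y = G x \<bullet> e (\<rho>1 a y)" for x y
    by (simp add: self_adjoint e_\<rho>)
  ultimately show thesis
    by (rule that)
qed

section \<open>Existence of the mirror\<close>

theorem corollary10p4p2:
  fixes sc :: "rat \<Rightarrow> 'd::ring_1 \<Rightarrow> 'd"
    and R :: "'d set"
    and \<rho>1 :: "'d \<Rightarrow> ('m::euclidean_space \<Rightarrow>\<^sub>L 'm)"
    and \<rho>2 :: "'d \<Rightarrow> ('n::euclidean_space \<Rightarrow>\<^sub>L 'n)"
    and \<Gamma>1 :: "'m set"
    and \<Gamma>2 :: "'n set"
    and e :: "'m \<Rightarrow>\<^sub>L 'n"
    and g :: "'m \<Rightarrow>\<^sub>L 'm \<Rightarrow>\<^sub>L real"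
    and q1 q2 :: "'m \<Rightarrow>\<^sub>L 'm"
    and A :: "('m \<times> 'n) torus"
    and \<omega> :: "(('m \<times> 'n) \<Rightarrow>\<^sub>L ('m \<times> 'n) \<Rightarrow>\<^sub>L real) \<times> (('m \<times> 'n) \<Rightarrow>\<^sub>L ('m \<times> 'n) \<Rightarrow>\<^sub>L real)"
  assumes "G_construction sc R \<rho>1 \<rho>2 \<Gamma>1 \<Gamma>2 e g"
    and "q1 \<in> SC_real \<rho>1 \<Gamma>1 g" and "q2 \<in> SC_real \<rho>1 \<Gamma>1 g" and "invertible_blinfun q2"
    and "A = G_torus \<Gamma>1 \<Gamma>2 e q1 q2"
    and "End_torus A = diag_action \<rho>1 \<rho>2 ` R"
    and "\<omega> \<in> NS_C0 A"
  shows "\<exists>(B :: ('m \<times> 'n) torus) \<eta>. mirror_symmetric (A, \<omega>) (B, \<eta>)"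
proof -
  interpret G_construction sc R \<rho>1 \<rho>2 \<Gamma>1 \<Gamma>2 e g
    by (rule assms(1))
  note q2_inv = assms(4)
  have \<Gamma>: "full_lattice \<Gamma>1" "full_lattice \<Gamma>2"
    using module1 module2 by (simp_all add: lattice_module_def)
  have e_inv: "invertible_blinfun e"
    by (rule invertible_of_rational_bijection[OF \<Gamma> iso_bij])
  have g_inv: "invertible_blinfun g"
    by (rule invertible_nondegenerate_form[OF g_nondegenerate])
  \<comment> \<open>The form \<open>g\<close> as a map from \<open>M\<close> to the dual of \<open>N\<close>, where the dual is taken along \<open>e\<close>.\<close>
  define G where "G = riesz_inv o\<^sub>L (transpose_blinfun (inv_blinfun e) o\<^sub>L g)"
  have G_inner: "G x \<bullet> y = g x (inv_blinfun e y)" for x y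
    by (simp add: G_def)
  have G_e: "G x \<bullet> e y = g x y" for x y
    by (simp add: G_inner e_inv)
  have G_inv: "invertible_blinfun G"
  proof -
    have "invertible_blinfun (transpose_blinfun (inv_blinfun e))"
      by (rule invertible_blinfunI[of "transpose_blinfun e"]) (auto intro!: blinfun_eqI simp: e_inv)
    then show ?thesis
      unfolding G_def by (intro invertible_blinfun_compose invertible_riesz_inv g_inv)
  qed
  have sym: "G x \<bullet> e y = G y \<bullet> e x" for x y
    by (simp add: G_e g_symmetric)
  have rat: "G x \<bullet> y \<in> \<rat>" if x: "x \<in> \<Gamma>1" and y: "y \<in> \<Gamma>2" for x y
  proof -
    obtain y' where y': "y' \<in> rational_span \<Gamma>1" "e y' = y"
      using rational_span_base[OF y] by (metis bij_betw_imp_surj_on[OF iso_bij] imageE)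
    have "G x \<bullet> y = g x y'"
      using G_e[of x y'] y'(2) by simp
    then show ?thesis
      using g_rational[OF rational_span_base[OF x] y'(1)] by simp
  qed

  let ?S = "S_sym g (End_D \<rho>1 (rational_span \<Gamma>1))"
  \<comment> \<open>The real operators that are symmetric with respect to \<open>g\<close>; they contain \<open>S(C) \<otimes> \<real>\<close>.\<close>
  define self_adj where "self_adj = {q. \<forall>x y. G (blinfun_apply q x) \<bullet> e y = G x \<bullet> e (blinfun_apply q y)}"
  have subspace_self_adj: "subspace self_adj"
    by (auto simp: self_adj_def subspace_def blinfun.bilinear_simps inner_add_left inner_add_right)
  have S_self_adj: "?S \<subseteq> self_adj"
  proof
    fix q assume "q \<in> ?S"
    then have q: "g_adjoint g q = q"
      by (simp add: S_sym_def)
    have "g (q x) y = g x (q y)" for x y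
    proof -
      have "g (g_adjoint g q x) = transpose_blinfun q (g x)"
        by (simp add: g_adjoint_def g_inv)
      then show ?thesis
        by (simp add: q)
    qed
    then show "q \<in> self_adj"
      by (simp add: self_adj_def G_e)
  qed
  have q_self_adj: "q1 \<in> self_adj" "q2 \<in> self_adj"
    using assms(2,3) span_minimal[OF S_self_adj subspace_self_adj] by (auto simp: SC_real_def)

  \<comment> \<open>This subspace contains the symmetric elements of the real span of \<open>D\<close>, which is why it parametrizes the Neron-Severi space of \<open>A\<close>.\<close>
  define T where "T = {t \<in> self_adj. \<forall>q\<in>?S. q o\<^sub>L t = t o\<^sub>L q}"
  have "subspace {t. q o\<^sub>L t = t o\<^sub>L q}" for q :: "'m \<Rightarrow>\<^sub>L 'm"
    by (auto simp: subspace_def bounded_bilinear.add_left[OF bounded_bilinear_blinfun_compose]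
        bounded_bilinear.add_right[OF bounded_bilinear_blinfun_compose]
        bounded_bilinear.scaleR_left[OF bounded_bilinear_blinfun_compose]
        bounded_bilinear.scaleR_right[OF bounded_bilinear_blinfun_compose])
  then have subspace_T: "subspace T"
    using subspace_self_adj by (fastforce simp: T_def subspace_def)
  have "NS A \<subseteq> (\<lambda>t. skew_form (G o\<^sub>L t)) ` T"
  proof
    fix c assume "c \<in> NS A"
    then have c_NS: "c \<in> NS (G_torus \<Gamma>1 \<Gamma>2 e q1 q2)"
      by (simp only: assms(5))
    have End: "End_torus (G_torus \<Gamma>1 \<Gamma>2 e q1 q2) \<subseteq> range (diag_action \<rho>1 \<rho>2)"
      using assms(6) by (auto simp: assms(5))
    have q: "G (q1 x) \<bullet> e y = G x \<bullet> e (q1 y)" "G (q2 x) \<bullet> e y = G x \<bullet> e (q2 y)" for x y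
      using q_self_adj by (auto simp: self_adj_def)
    obtain r a where c: "c = skew_form (G o\<^sub>L (r *\<^sub>R \<rho>1 a))"
      and a: "\<And>x y. G (\<rho>1 a x) \<bullet> e y = G x \<bullet> e (\<rho>1 a y)"
      by (rule NS_G_torus[OF \<Gamma> G_inv e_inv q2_inv sym rat q End iso_equivariant c_NS]) (assumption+, rule that)
    have "\<rho>1 a \<in> T"
      using a by (auto simp: T_def self_adj_def S_sym_def End_D_def)
    then have "r *\<^sub>R \<rho>1 a \<in> T"
      by (rule subspace_scale[OF subspace_T])
    with c show "c \<in> (\<lambda>t. skew_form (G o\<^sub>L t)) ` T"
      by blast
  qed
  then have NS_span: "span (NS A) \<subseteq> (\<lambda>t. skew_form (G o\<^sub>L t)) ` T"
    by (intro span_minimal linear_subspace_image linear_skew_form_compose subspace_T)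
  obtain t1 t2 where t: "t1 \<in> T" "t2 \<in> T" and \<omega>: "\<omega> = (skew_form (G o\<^sub>L t1), skew_form (G o\<^sub>L t2))"
  proof -
    have "fst \<omega> \<in> (\<lambda>t. skew_form (G o\<^sub>L t)) ` T" "snd \<omega> \<in> (\<lambda>t. skew_form (G o\<^sub>L t)) ` T"
      using assms(7) NS_span by (auto simp: NS_C0_def)
    then show thesis
      by (elim imageE) (metis that prod.collapse)
  qed
  have t2_inv: "invertible_blinfun t2"
  proof (rule invertible_blinfun_of_injective)
    fix x assume "t2 x = 0"
    then have "\<forall>w. skew_form (G o\<^sub>L t2) (x, 0) w = 0"
      by simp
    then have "(x, 0 :: 'n) = 0"
      using assms(7) unfolding \<omega> NS_C0_def nondegenerate_form_def by blast
    then show "x = 0"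
      by (simp add: zero_prod_def)
  qed

  define B where "B = G_torus \<Gamma>1 (dual_lattice \<Gamma>2) G t1 t2"
  define \<eta> where "\<eta> = (skew_form (e o\<^sub>L q1), skew_form (e o\<^sub>L q2))"
  have "skew_form (e o\<^sub>L q) \<in> span (NS B)" if q: "q \<in> ?S" for q
  proof (rule skew_form_in_span_NS)
    show "full_lattice (\<Gamma>1 \<times> dual_lattice \<Gamma>2)"
      by (intro full_lattice_Times full_lattice_dual \<Gamma>)
    show "lat B = \<Gamma>1 \<times> dual_lattice \<Gamma>2"
      by (simp add: B_def)
  next
    fix x y assume x: "x \<in> \<Gamma>1" and y: "y \<in> dual_lattice \<Gamma>2"
    have "q x \<in> rational_span \<Gamma>1"
      using q rational_span_base[OF x] by (auto simp: S_sym_def End_D_def)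
    then have "e (q x) \<in> rational_span \<Gamma>2"
      by (rule bij_betw_apply[OF iso_bij])
    then obtain r z where z: "z \<in> \<Gamma>2" "e (q x) = of_rat r *\<^sub>R z"
      unfolding rational_span_def by blast
    have "z \<bullet> y \<in> \<int>"
      using y z(1) by (auto simp: dual_lattice_def inner_commute)
    then show "(e o\<^sub>L q) x \<bullet> y \<in> \<rat>"
      using Ints_subset_Rats by (auto simp: z(2) intro!: Rats_mult)
  next
    fix v w
    show "skew_form (e o\<^sub>L q) (cstr B v) (cstr B w) = skew_form (e o\<^sub>L q) v w"
      unfolding B_def
      using q t S_self_adj by (intro skew_form_invariant G_inv t2_inv sym) (auto simp: T_def self_adj_def)
  qed
  then have "(\<lambda>q. skew_form (e o\<^sub>L q)) ` ?S \<subseteq> span (NS B)"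
    by (rule image_subsetI)
  then have "span ((\<lambda>q. skew_form (e o\<^sub>L q)) ` ?S) \<subseteq> span (NS B)"
    by (rule span_minimal[OF _ subspace_span])
  then have "skew_form (e o\<^sub>L q) \<in> span (NS B)" if "q \<in> SC_real \<rho>1 \<Gamma>1 g" for q
    using that by (auto simp: SC_real_def linear_span_image[OF linear_skew_form_compose])
  then have \<eta>: "\<eta> \<in> NS_C0 B"
    using assms(2,3) skew_form_nondegenerate[OF invertible_blinfun_compose[OF e_inv q2_inv]]
    unfolding NS_C0_def \<eta>_def by blast
  have "mirror_symmetric (A, \<omega>) (B, \<eta>)"
    using mirror_symmetric_G_tori[OF \<Gamma> G_inv e_inv q2_inv t2_inv, of t1 q1] assms(7) \<eta>
    by (simp only: assms(5) B_def \<omega> \<eta>_def)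
  then show ?thesis
    by blast
qed

end
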